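(* Let $\hat\mu$ be a solution of the quantum SG-Yang-Mills PDE $\widehat{(YM)}$ with corresponding quantum metric $\widehat g$ on $M$, and let $\hat\omega$ be a quantum Levi-Civita connection belonging to $\hat\mu$. If $\hat\omega$ comes from a quantum Higgs-symmetry breaking mechanism in which $\widehat g$ is identified with the quantum Higgs field, then the covariant derivative identified by $\hat\omega$ satisfies ${}^{\hat\omega}\nabla\widehat g=0$.
   Context: Setting. $A$ is a quantum (super)algebra (unital associative Fréchet $\mathbb K$-algebra, $\mathbb K=\mathbb R$ or $\mathbb C$, $\mathbb Z_2$-graded in the super case, with Noetherian center $Z$). $M$ is a quantum (super)manifold over $A$ (modelled on powers of $A$, with weakly smooth transition maps having $Z$-linear derivatives). $\mathbf N$ is the 4-dimensional Minkowski space with metric $\eta$. $\mathfrak g$ is a quantum superextension of the Poincaré Lie algebra with splitting $\mathfrak g=\mathfrak g_{\mathrm v}+\mathfrak g_{\mathrm L}+\mathfrak g_{\mathrm d}$, $\mathfrak g_{\mathrm v}=A\otimes_{\mathbb R}\mathbf N$, $\mathfrak g_{\mathrm L}$ the extension of the Lorentz part. $\widehat{(YM)}$ is the second order PDE for sections $\hat\mu=Z_K\otimes\hat\mu^K_Adx^A$ of $W=Hom_Z(TM;\mathfrak g)\to M$ given by the Euler-Lagrange equation of $L=\frac12\hat R^K_{AB}\hat R^{AB}_K$, where $\hat R$ is the curvature of $\hat\mu$. When the component $\hat\mu_{\mathrm v}=\hat\theta$ in $\mathfrak g_{\mathrm v}$ is pointwise an isomorphism $T_pM\cong A\otimes\mathbf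 N$ (quantum vierbein), the quantum metric corresponding to $\hat\mu$ is $\widehat g=\hat\theta^a_\alpha\hat\theta^b_\beta\,\eta_{ab}\,dx^\alpha\otimes dx^\beta:M\to Hom_Z(TM\otimes_ZTM;A)$. The connection $\hat\omega$ is the Lorentz part of $\hat\mu$, seen as a principal connection. Quantum Higgs-symmetry breaking. For a $G$-principal bundle $P\to M$ and closed subgroup $H\subset G$ (in the category of quantum supermanifolds), a quantum Higgs field is a global section $\hat h:M\to P/H$; it determines the $H$-reduction ${}^{\hat h}P=\pi_H^{-1}(\hat h(M))\subset P$, $\pi_H:P\to P/H$. Here $P=\mathcal E(M)$ is the principal bundle of linear frames of $M$, with structure group $GL(4,A)$, assumed reducible to $H=SO(1,3)$; there is an injection $i:\mathcal E(M)/SO(1,3)\to Hom_Z(TM\otimes_ZTM;A)$, and $\hat h$ is identified with the locally Minkowskian quantum metric $\widehat g=i\circ\hat h$. "$\hat\omega$ comes from a quantum Higgs-symmetry breaking mechanism" means that $\hat\omega$ is the principal connection on $\mathcal E(M)$ obtained by extending a principal connection ${}^{\hat h}\hat\omega$ on the reduced bundle ${}^{\hat h}\mathcal E(M)$; it induces covariant derivatives ${}^{\hat\omega}\nabla$ on $TM$ and associated bundles. *)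

theory Defs
  imports "HOL-Analysis.Analysis" "HOL-Algebra.Ring_Divisibility"
begin

section \<open>Quantum (super)algebras\<close>

definition seminorm :: "('a::real_vector \<Rightarrow> real) \<Rightarrow> bool" where
  "seminorm q \<longleftrightarrow> (\<forall>x y. q (x + y) \<le> q x + q y) \<and> (\<forall>r x. q (r *\<^sub>R x) = \<bar>r\<bar> * q x)"

text \<open>The topology of the type is the locally convex topology of a countable family of seminorms,
  and it is sequentially complete. Hausdorffness comes from the class \<open>t2_space\<close>.\<close>

definition frechet :: "'a::{real_vector,t2_space} itself \<Rightarrow> bool" where
  "frechet _ \<longleftrightarrow> (\<exists>q :: nat \<Rightarrow> 'a \<Rightarrow> real.
     (\<forall>n. seminorm (q n)) \<and>
     (\<forall>U. open U \<longleftrightarrow> (\<forall>x\<in>U. \<exists>n. \<exists>e>0. {y. \<forall>i\<le>n. q i (y - x) < e} \<subseteq> U)) \<and>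
     (\<forall>X :: nat \<Rightarrow> 'a. (\<forall>i. \<forall>e>0. \<exists>N. \<forall>m\<ge>N. \<forall>n\<ge>N. q i (X m - X n) < e) \<longrightarrow> convergent X))"

definition center :: "'a::ring_1 set" where
  "center = {z. \<forall>a. z * a = a * z}"

definition center_ring :: "'a::ring_1 ring" where
  "center_ring = \<lparr>carrier = center, mult = (*), one = 1, zero = 0, add = (+)\<rparr>"

text \<open>A type \<open>'k\<close> of class \<open>real_normed_field\<close> is, by the Gelfand--Mazur theorem, isomorphic to the
  real or the complex numbers, so it serves as the ground field. \<open>A0\<close> and \<open>A1\<close> are the even and
  the odd part; an ungraded quantum algebra is the case \<open>A0 = UNIV\<close>, \<open>A1 = {0}\<close>.\<close>

definition quantum_superalgebra ::
  "('k::real_normed_field \<Rightarrow> 'a \<Rightarrow> 'a) \<Rightarrow> 'a::{real_algebra_1,t2_space} set \<Rightarrow> 'a set \<Rightarrow> bool" where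
  "quantum_superalgebra sK A0 A1 \<longleftrightarrow>
     frechet TYPE('a) \<and>
     continuous_on UNIV (\<lambda>(x::'a, y). x * y) \<and>
     vector_space sK \<and>
     (\<forall>r x. sK (of_real r) x = r *\<^sub>R x) \<and>
     (\<forall>k x y. sK k (x * y) = sK k x * y \<and> sK k (x * y) = x * sK k y) \<and>
     continuous_on UNIV (\<lambda>(k, x). sK k x) \<and>
     module.subspace sK A0 \<and> module.subspace sK A1 \<and> closed A0 \<and> closed A1 \<and>
     A0 \<inter> A1 = {0} \<and> (\<forall>x. \<exists>a\<in>A0. \<exists>b\<in>A1. x = a + b) \<and>
     (\<forall>x\<in>A0. \<forall>y\<in>A0. x * y \<in> A0) \<and> (\<forall>x\<in>A0. \<forall>y\<in>A1. x * y \<in> A1) \<and>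
     (\<forall>x\<in>A1. \<forall>y\<in>A0. x * y \<in> A1) \<and> (\<forall>x\<in>A1. \<forall>y\<in>A1. x * y \<in> A0) \<and>
     noetherian_ring (center_ring :: 'a ring)"

section \<open>Weak differential calculus\<close>

definition wder_exists ::
  "('e \<Rightarrow> 'f) \<Rightarrow> 'e::real_vector \<Rightarrow> 'e \<Rightarrow> 'f::{real_vector,topological_space} \<Rightarrow> bool" where
  "wder_exists f x v L \<longleftrightarrow> ((\<lambda>t::real. (1 / t) *\<^sub>R (f (x + t *\<^sub>R v) - f x)) \<longlongrightarrow> L) (at 0)"

definition wder ::
  "('e \<Rightarrow> 'f) \<Rightarrow> 'e::real_vector \<Rightarrow> 'e \<Rightarrow> 'f::{real_vector,topological_space}" where
  "wder f x v = (THE L. wder_exists f x v L)"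

text \<open>\<open>wderiv k f v x\<close> is the \<open>k\<close>-th derivative of \<open>f\<close> at \<open>x\<close> in the directions
  \<open>v 0, \<dots>, v (k - 1)\<close>. A map is weakly smooth if all of these exist and are jointly continuous in
  the point and the directions. Only finitely many \<open>v i\<close> matter, so continuity in the product
  topology of \<open>nat \<Rightarrow> 'e\<close> is continuity on \<open>U \<times> E\<^sup>k\<close>.\<close>

primrec wderiv ::
  "nat \<Rightarrow> ('e \<Rightarrow> 'f) \<Rightarrow> (nat \<Rightarrow> 'e) \<Rightarrow> 'e::real_vector \<Rightarrow> 'f::{real_vector,topological_space}" where
  "wderiv 0 f v = f"
| "wderiv (Suc k) f v = (\<lambda>x. wder (wderiv k f v) x (v k))"

definition wsmooth ::
  "'e::{real_vector,topological_space} set \<Rightarrow> ('e \<Rightarrow> 'f::{real_vector,topological_space}) \<Rightarrow> bool" where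
  "wsmooth U f \<longleftrightarrow> open U \<and>
     (\<forall>k v u. \<forall>x\<in>U. \<exists>L. wder_exists (wderiv k f v) x u L) \<and>
     (\<forall>k. continuous_on (U \<times> UNIV) (\<lambda>(x, v). wderiv k f v x))"

text \<open>Linearity over the center \<open>Z\<close>, for explicitly given scalar multiplications.\<close>

definition zlinear ::
  "('a::ring_1 \<Rightarrow> 'e \<Rightarrow> 'e) \<Rightarrow> ('a \<Rightarrow> 'f \<Rightarrow> 'f) \<Rightarrow> ('e::plus \<Rightarrow> 'f::plus) \<Rightarrow> bool" where
  "zlinear s1 s2 f \<longleftrightarrow> (\<forall>x y. f (x + y) = f x + f y) \<and> (\<forall>z\<in>center. \<forall>x. f (s1 z x) = s2 z (f x))"

definition qsmooth ::
  "('a::ring_1 \<Rightarrow> 'e \<Rightarrow> 'e) \<Rightarrow> ('a \<Rightarrow> 'f \<Rightarrow> 'f) \<Rightarrow> 'e::{real_vector,topological_space} set \<Rightarrow>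
    ('e \<Rightarrow> 'f::{real_vector,topological_space}) \<Rightarrow> bool" where
  "qsmooth s1 s2 U f \<longleftrightarrow> wsmooth U f \<and> (\<forall>x\<in>U. zlinear s1 s2 (wder f x))"

abbreviation sc2 :: "'a::ring_1 \<Rightarrow> ('a^4) \<times> ('a^4) \<Rightarrow> ('a^4) \<times> ('a^4)" where
  "sc2 z \<equiv> map_prod ((*s) z) ((*s) z)"

abbreviation sc3 :: "'a::ring_1 \<Rightarrow> ('a^4) \<times> ('a^4) \<times> ('a^4) \<Rightarrow> ('a^4) \<times> ('a^4) \<times> ('a^4)" where
  "sc3 z \<equiv> map_prod ((*s) z) (sc2 z)"

section \<open>Quantum manifolds of dimension 4\<close>

type_synonym ('m, 'a) chart = "'m set \<times> ('m \<Rightarrow> 'a^4)"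

abbreviation cdom :: "('m, 'a) chart \<Rightarrow> 'm set" where "cdom c \<equiv> fst c"
abbreviation cmap :: "('m, 'a) chart \<Rightarrow> 'm \<Rightarrow> 'a^4" where "cmap c \<equiv> snd c"
abbreviation cinv :: "('m, 'a) chart \<Rightarrow> 'a^4 \<Rightarrow> 'm" where "cinv c \<equiv> inv_into (fst c) (snd c)"

definition charts_at :: "('m, 'a) chart set \<Rightarrow> 'm \<Rightarrow> ('m, 'a) chart set" where
  "charts_at At p = {c \<in> At. p \<in> cdom c}"

definition quantum_manifold ::
  "('m::t2_space, 'a::{real_algebra_1,t2_space}) chart set \<Rightarrow> bool" where
  "quantum_manifold At \<longleftrightarrow>
     (\<Union>c\<in>At. cdom c) = UNIV \<and>
     (\<forall>c\<in>At. open (cdom c) \<and> open (cmap c ` cdom c) \<and>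
        homeomorphism (cdom c) (cmap c ` cdom c) (cmap c) (cinv c)) \<and>
     (\<forall>c\<in>At. \<forall>d\<in>At. qsmooth (*s) (*s) (cmap c ` (cdom c \<inter> cdom d)) (cmap d \<circ> cinv c))"

text \<open>A tangent vector at \<open>p\<close> is the family of its coordinate vectors in the charts around \<open>p\<close>
  (and \<open>0\<close> at all other arguments); operations on tangent vectors are chartwise.\<close>

type_synonym ('m, 'a) tvec = "('m, 'a) chart \<Rightarrow> 'a^4"

definition tangent_space ::
  "('m, 'a::{real_algebra_1,t2_space}) chart set \<Rightarrow> 'm \<Rightarrow> ('m, 'a) tvec set" where
  "tangent_space At p = {v.
     (\<forall>c. c \<notin> charts_at At p \<longrightarrow> v c = 0) \<and>
     (\<forall>c\<in>charts_at At p. \<forall>d\<in>charts_at At p. v d = wder (cmap d \<circ> cinv c) (cmap c p) (v c))}"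

definition tadd :: "('m, 'a::ring_1) tvec \<Rightarrow> ('m, 'a) tvec \<Rightarrow> ('m, 'a) tvec" where
  "tadd v w = (\<lambda>c. v c + w c)"

definition tscale :: "'a::ring_1 \<Rightarrow> ('m, 'a) tvec \<Rightarrow> ('m, 'a) tvec" where
  "tscale z v = (\<lambda>c. z *s v c)"

definition tvec_of ::
  "('m, 'a::{real_algebra_1,t2_space}) chart set \<Rightarrow> ('m, 'a) chart \<Rightarrow> 'm \<Rightarrow> 'a^4 \<Rightarrow> ('m, 'a) tvec" where
  "tvec_of At c p w =
     (\<lambda>d. if d \<in> charts_at At p then wder (cmap d \<circ> cinv c) (cmap c p) w else 0)"

text \<open>Derivative at \<open>p\<close>, along a tangent vector, of a function on the manifold; by the chain rule it
  does not depend on the chart.\<close>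

definition dir_deriv ::
  "('m, 'a) chart set \<Rightarrow> ('m \<Rightarrow> 'f) \<Rightarrow> 'm \<Rightarrow> ('m, 'a::{real_algebra_1,t2_space}) tvec \<Rightarrow>
    'f::{real_vector,topological_space}" where
  "dir_deriv At f p v =
     (let c = (SOME c. c \<in> charts_at At p) in wder (f \<circ> cinv c) (cmap c p) (v c))"

section \<open>Minkowski form and superextensions of the Poincare algebra\<close>

definition eta :: "4 \<Rightarrow> 4 \<Rightarrow> real" where
  "eta a b = (if a = b then (if a = 0 then 1 else - 1) else 0)"

text \<open>The tensor product of \<open>A\<close> with Minkowski space is \<open>A\<^sup>4\<close>; the Minkowski metric induces
  the following \<open>A\<close>-valued form on it.\<close>

definition mink_form :: "'a::real_algebra_1^4 \<Rightarrow> 'a^4 \<Rightarrow> 'a" where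
  "mink_form x y = (\<Sum>a\<in>UNIV. \<Sum>b\<in>UNIV. eta a b *\<^sub>R (x$a * y$b))"

text \<open>The elements of the superextension are the vectors \<open>x :: 'a^'i\<close>, standing for
  \<open>\<Sum>I. x$I \<otimes> Z I\<close>. The generators \<open>P a\<close> of the translations are the \<open>Z (iv a)\<close> and the generators
  \<open>J a b\<close>, \<open>a < b\<close>, of the Lorentz part are the \<open>Z (il a b)\<close>; the remaining indices span the
  complementary summand.\<close>

abbreviation basis_gen :: "'i \<Rightarrow> 'a::real_algebra_1^'i" where
  "basis_gen I \<equiv> axis I 1"

definition J_gen :: "(4 \<Rightarrow> 4 \<Rightarrow> 'i) \<Rightarrow> 4 \<Rightarrow> 4 \<Rightarrow> 'a::real_algebra_1^'i" where
  "J_gen il a b = (if a < b then basis_gen (il a b) else if b < a then - basis_gen (il b a) else 0)"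

definition sbracket ::
  "('i \<Rightarrow> 'i \<Rightarrow> 'i \<Rightarrow> 'a) \<Rightarrow> 'a::real_algebra_1^'i \<Rightarrow> 'a^'i \<Rightarrow> 'a^'i" where
  "sbracket C x y = (\<chi> K. \<Sum>I\<in>UNIV. \<Sum>J\<in>UNIV. x$I * y$J * C I J K)"

definition ssign :: "bool \<Rightarrow> bool \<Rightarrow> real" where
  "ssign s t = (if s \<and> t then - 1 else 1)"

text \<open>\<open>C I J K\<close> is the coefficient of \<open>Z K\<close> in the bracket of \<open>Z I\<close> and \<open>Z J\<close>;
  \<open>oddg I\<close> says that \<open>Z I\<close> is odd.\<close>

definition poincare_superextension ::
  "'a::real_algebra_1 set \<Rightarrow> ('i::finite \<Rightarrow> bool) \<Rightarrow> ('i \<Rightarrow> 'i \<Rightarrow> 'i \<Rightarrow> 'a) \<Rightarrow>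
    (4 \<Rightarrow> 'i) \<Rightarrow> (4 \<Rightarrow> 4 \<Rightarrow> 'i) \<Rightarrow> bool" where
  "poincare_superextension A0 oddg C iv il \<longleftrightarrow>
     inj iv \<and> inj_on (\<lambda>(a, b). il a b) {(a, b). a < b} \<and>
     (\<forall>a b c. a < b \<longrightarrow> il a b \<noteq> iv c) \<and>
     (\<forall>a. \<not> oddg (iv a)) \<and> (\<forall>a b. a < b \<longrightarrow> \<not> oddg (il a b)) \<and>
     (\<forall>I J K. C I J K \<in> center \<inter> A0) \<and>
     (\<forall>I J K. C I J K \<noteq> 0 \<longrightarrow> oddg K = (oddg I \<noteq> oddg J)) \<and>
     (\<forall>I J K. C J I K = - (ssign (oddg I) (oddg J) *\<^sub>R C I J K)) \<and>
     (\<forall>I J K. sbracket C (basis_gen I) (sbracket C (basis_gen J) (basis_gen K)) =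
        sbracket C (sbracket C (basis_gen I) (basis_gen J)) (basis_gen K) +
        ssign (oddg I) (oddg J) *\<^sub>R
          sbracket C (basis_gen J) (sbracket C (basis_gen I) (basis_gen K))) \<and>
     (\<forall>a b. sbracket C (basis_gen (iv a)) (basis_gen (iv b)) = 0) \<and>
     (\<forall>a b c. sbracket C (J_gen il a b) (basis_gen (iv c)) =
        eta b c *\<^sub>R basis_gen (iv a) - eta a c *\<^sub>R basis_gen (iv b)) \<and>
     (\<forall>a b c d. sbracket C (J_gen il a b) (J_gen il c d) =
        eta b c *\<^sub>R J_gen il a d - eta a c *\<^sub>R J_gen il b d
        - eta b d *\<^sub>R J_gen il a c + eta a d *\<^sub>R J_gen il b c)"

text \<open>The matrix by which \<open>J a b\<close> acts on Minkowski space, and the matrix by which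
  the Lorentz part of an element of the superextension acts on \<open>A\<^sup>4\<close>.\<close>

definition J_matrix :: "4 \<Rightarrow> 4 \<Rightarrow> real^4^4" where
  "J_matrix a b =
     (\<chi> c d. (if c = a then eta b d else 0) - (if c = b then eta a d else 0))"

definition lorentz_part :: "(4 \<Rightarrow> 4 \<Rightarrow> 'i) \<Rightarrow> 'a::real_algebra_1^'i \<Rightarrow> 'a^4^4" where
  "lorentz_part il x = (\<chi> c d. \<Sum>(a, b) | a < b. (J_matrix a b $ c $ d) *\<^sub>R (x $ il a b))"

definition vector_part :: "(4 \<Rightarrow> 'i) \<Rightarrow> 'a^'i \<Rightarrow> 'a^4" where
  "vector_part iv x = (\<chi> a. x $ iv a)"

section \<open>The quantum SG-Yang-Mills equation\<close>

definition hom_section ::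
  "('m, 'a::{real_algebra_1,t2_space}) chart set \<Rightarrow> ('m \<Rightarrow> ('m, 'a) tvec \<Rightarrow> 'a^'i::finite) \<Rightarrow> bool" where
  "hom_section At \<mu> \<longleftrightarrow>
     (\<forall>p. \<forall>v\<in>tangent_space At p. \<forall>w\<in>tangent_space At p. \<mu> p (tadd v w) = \<mu> p v + \<mu> p w) \<and>
     (\<forall>p. \<forall>v\<in>tangent_space At p. \<forall>z\<in>center. \<mu> p (tscale z v) = z *s \<mu> p v) \<and>
     (\<forall>c\<in>At. qsmooth sc2 (*s) ((cmap c ` cdom c) \<times> UNIV)
        (\<lambda>(x, w). \<mu> (cinv c x) (tvec_of At c (cinv c x) w)))"

text \<open>Coordinate expressions: \<open>m $ A $ K\<close> is the value of the \<open>K\<close>-th component of the field on the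
  \<open>A\<close>-th coordinate vector, \<open>d $ A $ B $ K\<close> is the derivative of \<open>m $ B $ K\<close> along the \<open>A\<close>-th
  coordinate vector.\<close>

definition field_comp ::
  "('m, 'a::{real_algebra_1,t2_space}) chart set \<Rightarrow> ('m \<Rightarrow> ('m, 'a) tvec \<Rightarrow> 'a^'i::finite) \<Rightarrow>
    ('m, 'a) chart \<Rightarrow> 'a^4 \<Rightarrow> 'a^'i^4" where
  "field_comp At \<mu> c x = (\<chi> A. \<mu> (cinv c x) (tvec_of At c (cinv c x) (axis A 1)))"

definition field_deriv ::
  "('m, 'a::{real_algebra_1,t2_space}) chart set \<Rightarrow> ('m \<Rightarrow> ('m, 'a) tvec \<Rightarrow> 'a^'i::finite) \<Rightarrow>
    ('m, 'a) chart \<Rightarrow> 'a^4 \<Rightarrow> 'a^'i^4^4" where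
  "field_deriv At \<mu> c x = (\<chi> A. wder (field_comp At \<mu> c) x (axis A 1))"

text \<open>Components of the curvature \<open>d\<mu> + 1/2 [\<mu>, \<mu>]\<close>.\<close>

definition curvature ::
  "('i::finite \<Rightarrow> 'i \<Rightarrow> 'i \<Rightarrow> 'a) \<Rightarrow> 'a::real_algebra_1^'i^4 \<Rightarrow> 'a^'i^4^4 \<Rightarrow> 4 \<Rightarrow> 4 \<Rightarrow> 'a^'i" where
  "curvature C m d A B = d$A$B - d$B$A +
     (1/2) *\<^sub>R (sbracket C (m$A) (m$B) - sbracket C (m$B) (m$A))"

text \<open>The Lagrangian \<open>1/2 R\<^sup>K\<^sub>A\<^sub>B R\<^sup>A\<^sup>B\<^sub>K\<close>. Indices \<open>A\<close>, \<open>B\<close> are raised by the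
  contravariant metric components \<open>G\<close> and \<open>K\<close> is lowered by the components \<open>\<kappa>\<close> of a metric on
  the superextension.\<close>

definition lagrangian ::
  "('i::finite \<Rightarrow> 'i \<Rightarrow> 'i \<Rightarrow> 'a) \<Rightarrow> 'a^'i^'i \<Rightarrow> 'a^4^4 \<Rightarrow>
    'a::real_algebra_1^'i^4 \<Rightarrow> 'a^'i^4^4 \<Rightarrow> 'a" where
  "lagrangian C \<kappa> G m d = (1/2) *\<^sub>R (\<Sum>A\<in>UNIV. \<Sum>B\<in>UNIV. \<Sum>K\<in>UNIV.
     curvature C m d A B $ K *
     (\<Sum>A'\<in>UNIV. \<Sum>B'\<in>UNIV. \<Sum>L\<in>UNIV.
        G$A$A' * G$B$B' * curvature C m d A' B' $ L * \<kappa>$L$K))"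

text \<open>The metric used for raising indices may be a background metric or be built from the
  field itself, so in each chart it is a function of the point and of the values \<open>m\<close> of the field,
  smooth and nondegenerate near the given section.\<close>

definition contraction_metrics ::
  "('m, 'a::{real_algebra_1,t2_space}) chart set \<Rightarrow> 'a set \<Rightarrow> 'a^'i^'i \<Rightarrow>
    (('m, 'a) chart \<Rightarrow> ('a^4) \<times> ('a^'i^4) \<Rightarrow> 'a^4^4) \<Rightarrow>
    ('m \<Rightarrow> ('m, 'a) tvec \<Rightarrow> 'a^'i::finite) \<Rightarrow> bool" where
  "contraction_metrics At A0 \<kappa> G \<mu> \<longleftrightarrow>
     invertible \<kappa> \<and> (\<forall>I J. \<kappa>$I$J \<in> center \<inter> A0) \<and>
     (\<forall>c\<in>At. \<exists>W. (\<forall>x \<in> cmap c ` cdom c. (x, field_comp At \<mu> c x) \<in> W) \<and>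
        wsmooth W (G c) \<and> (\<forall>y\<in>W. invertible (G c y)))"

text \<open>The Euler-Lagrange equations. The partial derivatives of the Lagrangian are
  \<open>Z\<close>-linear maps from \<open>A\<close> to \<open>A\<close>; the variable \<open>\<delta>\<close> is their argument.\<close>

definition YM_solution ::
  "('m, 'a::{real_algebra_1,t2_space}) chart set \<Rightarrow> ('i::finite \<Rightarrow> 'i \<Rightarrow> 'i \<Rightarrow> 'a) \<Rightarrow> 'a^'i^'i \<Rightarrow>
    (('m, 'a) chart \<Rightarrow> ('a^4) \<times> ('a^'i^4) \<Rightarrow> 'a^4^4) \<Rightarrow>
    ('m \<Rightarrow> ('m, 'a) tvec \<Rightarrow> 'a^'i) \<Rightarrow> bool" where
  "YM_solution At C \<kappa> G \<mu> \<longleftrightarrow>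
     hom_section At \<mu> \<and>
     (\<forall>c\<in>At. \<forall>x \<in> cmap c ` cdom c. \<forall>B K \<delta>.
        (\<Sum>A\<in>UNIV. wder
           (\<lambda>x'. wder (\<lambda>d. lagrangian C \<kappa> (G c (x', field_comp At \<mu> c x')) (field_comp At \<mu> c x') d)
                    (field_deriv At \<mu> c x') (axis A (axis B (axis K \<delta>))))
           x (axis A 1))
        = wder (\<lambda>m. lagrangian C \<kappa> (G c (x, m)) m (field_deriv At \<mu> c x))
            (field_comp At \<mu> c x) (axis B (axis K \<delta>)))"

text \<open>The vierbein belonging to a field, and the quantum metric built from it.\<close>

definition vierbein ::
  "(4 \<Rightarrow> 'i) \<Rightarrow> ('m \<Rightarrow> ('m, 'a) tvec \<Rightarrow> 'a^'i) \<Rightarrow> 'm \<Rightarrow> ('m, 'a) tvec \<Rightarrow> 'a^4" where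
  "vierbein iv \<mu> p v = vector_part iv (\<mu> p v)"

definition is_vierbein ::
  "('m, 'a::{real_algebra_1,t2_space}) chart set \<Rightarrow> ('m \<Rightarrow> ('m, 'a) tvec \<Rightarrow> 'a^4) \<Rightarrow> bool" where
  "is_vierbein At \<theta> \<longleftrightarrow> (\<forall>p. bij_betw (\<theta> p) (tangent_space At p) UNIV)"

definition quantum_metric ::
  "(4 \<Rightarrow> 'i) \<Rightarrow> ('m \<Rightarrow> ('m, 'a) tvec \<Rightarrow> 'a^'i) \<Rightarrow>
    'm \<Rightarrow> ('m, 'a) tvec \<Rightarrow> ('m, 'a) tvec \<Rightarrow> 'a::real_algebra_1" where
  "quantum_metric iv \<mu> p v w = mink_form (vierbein iv \<mu> p v) (vierbein iv \<mu> p w)"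

section \<open>The frame bundle and its reductions\<close>

text \<open>Since tangent maps of transition functions are only \<open>Z\<close>-linear, the structure group
  of the bundle of linear frames consists of the \<open>Z\<close>-linear topological automorphisms of \<open>A\<^sup>4\<close>.\<close>

definition GL4 :: "('a::{real_algebra_1,t2_space}^4 \<Rightarrow> 'a^4) set" where
  "GL4 = {T. bij T \<and> zlinear (*s) (*s) T \<and>
            continuous_on UNIV T \<and> continuous_on UNIV (inv_into UNIV T)}"

definition gl4 :: "('a::{real_algebra_1,t2_space}^4 \<Rightarrow> 'a^4) set" where
  "gl4 = {B. zlinear (*s) (*s) B \<and> continuous_on UNIV B}"

text \<open>The Lorentz group and its Lie algebra inside \<open>GL4\<close> and \<open>gl4\<close>, with matrix entries in the
  center: the real matrices alone are not a \<open>Z\<close>-module, and noncentral matrices do not preserve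
  \<open>mink_form\<close>. For central entries, the order of the factors in the determinant is irrelevant.\<close>

definition cdet4 :: "'a::real_algebra_1^4^4 \<Rightarrow> 'a" where
  "cdet4 L = (\<Sum>\<sigma> | \<sigma> permutes (UNIV :: 4 set).
     of_int (sign \<sigma>) * (L $ 0 $ \<sigma> 0 * L $ 1 $ \<sigma> 1 * L $ 2 $ \<sigma> 2 * L $ 3 $ \<sigma> 3))"

definition SO13 :: "('a::{real_algebra_1,t2_space}^4 \<Rightarrow> 'a^4) set" where
  "SO13 = {T \<in> GL4. \<exists>L :: 'a^4^4. T = (*v) L \<and> (\<forall>a b. L$a$b \<in> center) \<and>
     (\<forall>a b. (\<Sum>c\<in>UNIV. \<Sum>d\<in>UNIV. eta c d *\<^sub>R (L$c$a * L$d$b)) = of_real (eta a b)) \<and>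
     cdet4 L = 1}"

definition so13 :: "('a::{real_algebra_1,t2_space}^4 \<Rightarrow> 'a^4) set" where
  "so13 = {X. \<exists>B :: 'a^4^4. X = (*v) B \<and> (\<forall>a b. B$a$b \<in> center) \<and>
     (\<forall>a b. (\<Sum>c\<in>UNIV. eta c b *\<^sub>R (B$c$a) + eta a c *\<^sub>R (B$c$b)) = 0)}"

type_synonym ('m, 'a) frame = "'a^4 \<Rightarrow> ('m, 'a) tvec"

definition frame_bundle ::
  "('m, 'a::{real_algebra_1,t2_space}) chart set \<Rightarrow> 'm \<Rightarrow> ('m, 'a) frame set" where
  "frame_bundle At p = {u. (\<forall>y. u y \<in> tangent_space At p) \<and>
     (\<forall>c\<in>charts_at At p. (\<lambda>y. u y c) \<in> GL4)}"

text \<open>A subbundle \<open>Q\<close> of the frame bundle is given by its fibres. Smoothness of a map with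
  values in \<open>GL4\<close> means joint smoothness of the action and of the inverse action on \<open>A\<^sup>4\<close>.\<close>

definition local_section ::
  "('m::t2_space, 'a::{real_algebra_1,t2_space}) chart set \<Rightarrow> ('m \<Rightarrow> ('m, 'a) frame set) \<Rightarrow>
    'm set \<Rightarrow> ('m \<Rightarrow> ('m, 'a) frame) \<Rightarrow> bool" where
  "local_section At Q U s \<longleftrightarrow> open U \<and>
     (\<forall>p\<in>U. s p \<in> frame_bundle At p \<and> s p \<in> Q p) \<and>
     (\<forall>c\<in>At. qsmooth sc2 (*s) ((cmap c ` (U \<inter> cdom c)) \<times> UNIV) (\<lambda>(x, y). s (cinv c x) y c) \<and>
             qsmooth sc2 (*s) ((cmap c ` (U \<inter> cdom c)) \<times> UNIV)
               (\<lambda>(x, y). inv_into UNIV (\<lambda>y'. s (cinv c x) y' c) y))"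

text \<open>A tangent vector of the frame bundle at \<open>u\<close> is a pair of its projection to the base and of
  its component along the fibre, the latter given in each chart as an endomorphism of \<open>A\<^sup>4\<close>.\<close>

type_synonym ('m, 'a) ftvec = "('m, 'a) tvec \<times> (('m, 'a) chart \<Rightarrow> 'a^4 \<Rightarrow> 'a^4)"

definition ft_add :: "('m, 'a::ring_1) ftvec \<Rightarrow> ('m, 'a) ftvec \<Rightarrow> ('m, 'a) ftvec" where
  "ft_add \<zeta> \<xi> = (tadd (fst \<zeta>) (fst \<xi>), \<lambda>c y. snd \<zeta> c y + snd \<xi> c y)"

definition ft_scale :: "'a::ring_1 \<Rightarrow> ('m, 'a) ftvec \<Rightarrow> ('m, 'a) ftvec" where
  "ft_scale z \<zeta> = (tscale z (fst \<zeta>), \<lambda>c y. z *s snd \<zeta> c y)"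

text \<open>The tangent map of a local section; the fundamental vertical vector; the tangent map of the
  right translation by a structure group element.\<close>

definition pushforward ::
  "('m, 'a::{real_algebra_1,t2_space}) chart set \<Rightarrow> ('m \<Rightarrow> ('m, 'a) frame) \<Rightarrow> 'm \<Rightarrow>
    ('m, 'a) tvec \<Rightarrow> ('m, 'a) ftvec" where
  "pushforward At s p v = (v, \<lambda>c y. if c \<in> charts_at At p
     then wder (\<lambda>x. s (cinv c x) y c) (cmap c p) (v c) else 0)"

definition vertical :: "('m, 'a::ring_1) frame \<Rightarrow> ('a^4 \<Rightarrow> 'a^4) \<Rightarrow> ('m, 'a) ftvec" where
  "vertical u X = ((\<lambda>_. 0), \<lambda>c y. u (X y) c)"

definition right_transl :: "('a^4 \<Rightarrow> 'a^4) \<Rightarrow> ('m, 'a) ftvec \<Rightarrow> ('m, 'a) ftvec" where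
  "right_transl T \<zeta> = (fst \<zeta>, \<lambda>c. snd \<zeta> c \<circ> T)"

definition bundle_tangent ::
  "('m::t2_space, 'a::{real_algebra_1,t2_space}) chart set \<Rightarrow> ('a^4 \<Rightarrow> 'a^4) set \<Rightarrow>
    ('m \<Rightarrow> ('m, 'a) frame set) \<Rightarrow> 'm \<Rightarrow> ('m, 'a) frame \<Rightarrow> ('m, 'a) ftvec set" where
  "bundle_tangent At \<hh> Q p u = {\<zeta>. \<exists>U s v X. p \<in> U \<and> local_section At Q U s \<and> s p = u \<and>
     v \<in> tangent_space At p \<and> X \<in> \<hh> \<and> \<zeta> = ft_add (pushforward At s p v) (vertical u X)}"

text \<open>Connection forms on a principal subbundle \<open>Q\<close> with structure group \<open>H\<close> and Lie algebra
  \<open>\<hh>\<close>.\<close>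

definition principal_connection ::
  "('m::t2_space, 'a::{real_algebra_1,t2_space}) chart set \<Rightarrow> ('a^4 \<Rightarrow> 'a^4) set \<Rightarrow>
    ('a^4 \<Rightarrow> 'a^4) set \<Rightarrow> ('m \<Rightarrow> ('m, 'a) frame set) \<Rightarrow>
    ('m \<Rightarrow> ('m, 'a) frame \<Rightarrow> ('m, 'a) ftvec \<Rightarrow> 'a^4 \<Rightarrow> 'a^4) \<Rightarrow> bool" where
  "principal_connection At H \<hh> Q \<omega> \<longleftrightarrow>
     (\<forall>p. \<forall>u\<in>Q p.
        (\<forall>\<zeta>\<in>bundle_tangent At \<hh> Q p u. \<omega> p u \<zeta> \<in> \<hh>) \<and>
        (\<forall>\<zeta>\<in>bundle_tangent At \<hh> Q p u. \<forall>\<xi>\<in>bundle_tangent At \<hh> Q p u.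
           \<omega> p u (ft_add \<zeta> \<xi>) = (\<lambda>y. \<omega> p u \<zeta> y + \<omega> p u \<xi> y)) \<and>
        (\<forall>\<zeta>\<in>bundle_tangent At \<hh> Q p u. \<forall>z\<in>center.
           \<omega> p u (ft_scale z \<zeta>) = (\<lambda>y. z *s \<omega> p u \<zeta> y)) \<and>
        (\<forall>X\<in>\<hh>. \<omega> p u (vertical u X) = X) \<and>
        (\<forall>T\<in>H. \<forall>\<zeta>\<in>bundle_tangent At \<hh> Q p u.
           \<omega> p (u \<circ> T) (right_transl T \<zeta>) = inv_into UNIV T \<circ> \<omega> p u \<zeta> \<circ> T)) \<and>
     (\<forall>U s. local_section At Q U s \<longrightarrow>
        (\<forall>c\<in>At. qsmooth sc3 (*s) ((cmap c ` (U \<inter> cdom c)) \<times> UNIV)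
           (\<lambda>(x, w, y). \<omega> (cinv c x) (s (cinv c x))
              (pushforward At s (cinv c x) (tvec_of At c (cinv c x) w)) y)))"

text \<open>Higgs fields are sections of the quotient of the frame bundle by \<open>SO13\<close>; smooth ones are
  those with smooth local lifts to the frame bundle.\<close>

definition coset :: "('m, 'a::{real_algebra_1,t2_space}) frame \<Rightarrow> ('m, 'a) frame set" where
  "coset u = {u \<circ> T |T. T \<in> SO13}"

definition higgs_field ::
  "('m::t2_space, 'a::{real_algebra_1,t2_space}) chart set \<Rightarrow> ('m \<Rightarrow> ('m, 'a) frame set) \<Rightarrow> bool" where
  "higgs_field At h \<longleftrightarrow> (\<forall>p. h p \<in> coset ` frame_bundle At p) \<and>
     (\<forall>p. \<exists>U s. p \<in> U \<and> local_section At (frame_bundle At) U s \<and> (\<forall>q\<in>U. h q = coset (s q)))"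

definition reduction ::
  "('m, 'a::{real_algebra_1,t2_space}) chart set \<Rightarrow> ('m \<Rightarrow> ('m, 'a) frame set) \<Rightarrow>
    'm \<Rightarrow> ('m, 'a) frame set" where
  "reduction At h p = {u \<in> frame_bundle At p. coset u = h p}"

text \<open>The metric of a coset of frames: its frames are pseudo-orthonormal. The choice of the frame
  in the coset does not matter.\<close>

definition coset_metric ::
  "('m, 'a) frame set \<Rightarrow> ('m, 'a) tvec \<Rightarrow> ('m, 'a) tvec \<Rightarrow> 'a::real_algebra_1" where
  "coset_metric S v w =
     (let u = (SOME u. u \<in> S) in mink_form (inv_into UNIV u v) (inv_into UNIV u w))"

text \<open>A metric \<open>g\<close> identified with a Higgs field \<open>h\<close>, and a connection \<open>\<omega>\<close> on the frame bundle that
  extends a connection on the reduction given by \<open>h\<close>.\<close>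

definition from_higgs_breaking ::
  "('m::t2_space, 'a::{real_algebra_1,t2_space}) chart set \<Rightarrow>
    ('m \<Rightarrow> ('m, 'a) tvec \<Rightarrow> ('m, 'a) tvec \<Rightarrow> 'a) \<Rightarrow>
    ('m \<Rightarrow> ('m, 'a) frame \<Rightarrow> ('m, 'a) ftvec \<Rightarrow> 'a^4 \<Rightarrow> 'a^4) \<Rightarrow> bool" where
  "from_higgs_breaking At g \<omega> \<longleftrightarrow> (\<exists>h \<omega>h.
     higgs_field At h \<and>
     (\<forall>p. \<forall>v\<in>tangent_space At p. \<forall>w\<in>tangent_space At p. g p v w = coset_metric (h p) v w) \<and>
     principal_connection At SO13 so13 (reduction At h) \<omega>h \<and>
     principal_connection At GL4 gl4 (frame_bundle At) \<omega> \<and>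
     (\<forall>p. \<forall>u\<in>reduction At h p. \<forall>\<zeta>\<in>bundle_tangent At so13 (reduction At h) p u.
        \<omega> p u \<zeta> = \<omega>h p u \<zeta>))"

text \<open>The Lorentz part of \<open>\<mu>\<close> as a principal connection on the frame bundle: its potential in the
  moving frame \<open>\<theta>\<^sup>-\<^sup>1\<close> is the Lorentz part of \<open>\<mu>\<close>. Written for an arbitrary local frame \<open>s\<close>, this is
  the gauge transformation rule \<open>\<theta> s \<omega>\<^sub>s = d(\<theta> s) + \<mu>\<^sub>L \<theta> s\<close>.\<close>

definition levi_civita_belonging ::
  "('m::t2_space, 'a::{real_algebra_1,t2_space}) chart set \<Rightarrow> (4 \<Rightarrow> 'i) \<Rightarrow> (4 \<Rightarrow> 4 \<Rightarrow> 'i) \<Rightarrow>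
    ('m \<Rightarrow> ('m, 'a) tvec \<Rightarrow> 'a^'i::finite) \<Rightarrow>
    ('m \<Rightarrow> ('m, 'a) frame \<Rightarrow> ('m, 'a) ftvec \<Rightarrow> 'a^4 \<Rightarrow> 'a^4) \<Rightarrow> bool" where
  "levi_civita_belonging At iv il \<mu> \<omega> \<longleftrightarrow>
     principal_connection At GL4 gl4 (frame_bundle At) \<omega> \<and>
     (\<forall>U s. local_section At (frame_bundle At) U s \<longrightarrow>
        (\<forall>p\<in>U. \<forall>v\<in>tangent_space At p. \<forall>y.
           vierbein iv \<mu> p (s p (\<omega> p (s p) (pushforward At s p v) y)) =
           dir_deriv At (\<lambda>q. vierbein iv \<mu> q (s q y)) p v +
           lorentz_part il (\<mu> p v) *v vierbein iv \<mu> p (s p y)))"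

text \<open>The covariant derivative induced by \<open>\<omega>\<close> on the associated bundle of \<open>A\<close>-valued bilinear forms
  on tangent spaces, computed in a local frame \<open>s\<close>; the result does not depend on the frame.\<close>

definition cov_deriv_bilinear ::
  "('m, 'a::{real_algebra_1,t2_space}) chart set \<Rightarrow>
    ('m \<Rightarrow> ('m, 'a) frame \<Rightarrow> ('m, 'a) ftvec \<Rightarrow> 'a^4 \<Rightarrow> 'a^4) \<Rightarrow> ('m \<Rightarrow> ('m, 'a) frame) \<Rightarrow>
    ('m \<Rightarrow> ('m, 'a) tvec \<Rightarrow> ('m, 'a) tvec \<Rightarrow> 'a) \<Rightarrow>
    'm \<Rightarrow> ('m, 'a) tvec \<Rightarrow> ('m, 'a) tvec \<Rightarrow> ('m, 'a) tvec \<Rightarrow> 'a" where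
  "cov_deriv_bilinear At \<omega> s g p v w w' =
     (let y = inv_into UNIV (s p) w; y' = inv_into UNIV (s p) w';
          X = \<omega> p (s p) (pushforward At s p v)
      in dir_deriv At (\<lambda>q. g q (s q y) (s q y')) p v
           - g p (s p (X y)) w' - g p w (s p (X y')))"

end

theory Submission
  imports Defs
begin

text \<open>Write \<open>\<theta>\<close> for the vierbein and \<open>M\<close> for the Lorentz part of \<open>\<mu>\<close> along \<open>v\<close>. The Leibniz rule and the gauge
  transformation rule of \<open>\<omega>\<close> show that, in every local frame, the covariant derivative of the
  metric on \<open>w, w'\<close> is minus \<open>\<eta>(M \<theta> w, \<theta> w') + \<eta>(\<theta> w, M \<theta> w')\<close>. This expression does not depend on
  the frame, so it suffices to compute in one frame, namely a local lift of the Higgs field. There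
  the components of the metric are constant and \<open>\<omega>\<close> takes values in the Lorentz algebra, so the
  covariant derivative vanishes.\<close>

section \<open>Topological algebra\<close>

lemma tendsto_continuous_binop:
  assumes "continuous_on UNIV (\<lambda>(x, y). f x y)" "(g \<longlongrightarrow> a) F" "(h \<longlongrightarrow> b) F"
  shows "((\<lambda>t. f (g t) (h t)) \<longlongrightarrow> f a b) F"
  using continuous_on_tendsto_compose[OF assms(1) tendsto_Pair[OF assms(2,3)]] by simp

text \<open>The seminorms generate the topology, so continuity of addition follows from their
  triangle inequality by an e/2 argument.\<close>

lemma frechet_tendsto_add:
  fixes f g :: "'b \<Rightarrow> 'a::{real_vector,t2_space}"
  assumes "frechet TYPE('a)" "(f \<longlongrightarrow> a) F" "(g \<longlongrightarrow> b) F"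
  shows "((\<lambda>t. f t + g t) \<longlongrightarrow> a + b) F"
proof -
  obtain q :: "nat \<Rightarrow> 'a \<Rightarrow> real" where sn: "\<And>n. seminorm (q n)"
    and op: "\<And>U. open U \<longleftrightarrow> (\<forall>x\<in>U. \<exists>n. \<exists>e>0. {y. \<forall>i\<le>n. q i (y - x) < e} \<subseteq> U)"
    using assms(1) unfolding frechet_def by blast
  have tri: "q i (x + y) \<le> q i x + q i y" for i x y
    using sn unfolding seminorm_def by blast
  have q0: "q i 0 = 0" for i
    using sn[of i] unfolding seminorm_def by (metis abs_zero mult_zero_left scaleR_zero_left)
  have ball: "open {y. \<forall>i\<le>n. q i (y - x) < e}" for n x e
    unfolding op
  proof
    fix z assume z: "z \<in> {y. \<forall>i\<le>n. q i (y - x) < e}"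
    \<comment> \<open>\<open>m\<close> is the largest of finitely many seminorm values at
      \<open>z\<close>; the slack \<open>e - m\<close> is the radius of a ball around
      \<open>z\<close> inside the given one.\<close>
    define m where "m = Max ((\<lambda>i. q i (z - x)) ` {..n})"
    have "m < e" using z unfolding m_def by (subst Max_less_iff) auto
    have qm: "q i (z - x) \<le> m" if "i \<le> n" for i
      unfolding m_def using that by (intro Max_ge) auto
    have "q i (y - x) < e" if y: "\<forall>i\<le>n. q i (y - z) < e - m" and i: "i \<le> n" for y i
    proof -
      have "q i (y - x) \<le> q i (y - z) + q i (z - x)" using tri[of i "y - z" "z - x"] by simp
      then show ?thesis using qm[OF i] y i by fastforce
    qed
    then show "\<exists>k. \<exists>d>0. {y. \<forall>i\<le>k. q i (y - z) < d} \<subseteq> {y. \<forall>i\<le>n. q i (y - x) < e}"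
      using \<open>m < e\<close> by (intro exI[of _ n] exI[of _ "e - m"]) auto
  qed
  show ?thesis
  proof (rule topological_tendstoI)
    fix S assume "open S" "a + b \<in> S"
    then obtain n e where "e > 0" and S: "{y. \<forall>i\<le>n. q i (y - (a + b)) < e} \<subseteq> S"
      using op by blast
    have "eventually (\<lambda>t. f t \<in> {y. \<forall>i\<le>n. q i (y - a) < e/2}) F"
      by (rule topological_tendstoD[OF assms(2) ball]) (simp add: q0 \<open>e > 0\<close>)
    moreover have "eventually (\<lambda>t. g t \<in> {y. \<forall>i\<le>n. q i (y - b) < e/2}) F"
      by (rule topological_tendstoD[OF assms(3) ball]) (simp add: q0 \<open>e > 0\<close>)
    ultimately show "eventually (\<lambda>t. f t + g t \<in> S) F"
    proof eventually_elim
      case (elim t)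
      have "q i (f t + g t - (a + b)) < e" if i: "i \<le> n" for i
      proof -
        have "q i (f t - a) < e/2" "q i (g t - b) < e/2" using elim i by auto
        then show ?thesis using tri[of i "f t - a" "g t - b"] by (simp add: algebra_simps)
      qed
      then show ?case using S by auto
    qed
  qed
qed

text \<open>The type classes of \<open>'a\<close> do not tie the algebra to the topology, so the
  limit laws are bundled here. Functions of a real variable suffice, since weak derivatives are
  limits of difference quotients in a real parameter.\<close>

locale topological_real_algebra =
  fixes type :: "'a::{real_algebra_1,t2_space} itself"
  assumes tendsto_plus: "\<And>(f::real \<Rightarrow> 'a) g a b F.
      (f \<longlongrightarrow> a) F \<Longrightarrow> (g \<longlongrightarrow> b) F \<Longrightarrow> ((\<lambda>t. f t + g t) \<longlongrightarrow> a + b) F"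
    and tendsto_times: "\<And>(f::real \<Rightarrow> 'a) g a b F.
      (f \<longlongrightarrow> a) F \<Longrightarrow> (g \<longlongrightarrow> b) F \<Longrightarrow> ((\<lambda>t. f t * g t) \<longlongrightarrow> a * b) F"
    and tendsto_real_scale: "\<And>r (f::real \<Rightarrow> 'a) k a F.
      (r \<longlongrightarrow> k) F \<Longrightarrow> (f \<longlongrightarrow> a) F \<Longrightarrow> ((\<lambda>t. r t *\<^sub>R f t) \<longlongrightarrow> k *\<^sub>R a) F"

text \<open>Addition is continuous by the seminorms, multiplication by the axioms, and real scaling
  because it is the jointly continuous \<open>sK\<close> restricted to real scalars.\<close>

lemma topological_real_algebra_quantum:
  fixes sK :: "'k::real_normed_field \<Rightarrow> 'a::{real_algebra_1,t2_space} \<Rightarrow> 'a"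
  assumes "quantum_superalgebra sK A0 A1"
  shows "topological_real_algebra TYPE('a)"
proof
  have fre: "frechet TYPE('a)"
    using assms unfolding quantum_superalgebra_def by (elim conjE)
  have mul: "continuous_on UNIV (\<lambda>(x::'a, y). x * y)"
    using assms unfolding quantum_superalgebra_def by (elim conjE)
  have real: "\<forall>r x. sK (of_real r) x = r *\<^sub>R x"
    using assms unfolding quantum_superalgebra_def by (elim conjE)
  have scale: "continuous_on UNIV (\<lambda>(k, x). sK k x)"
    using assms unfolding quantum_superalgebra_def by (elim conjE)
  fix f g :: "real \<Rightarrow> 'a" and r :: "real \<Rightarrow> real" and a b k F
  assume f: "(f \<longlongrightarrow> a) F"
  show "((\<lambda>t. f t + g t) \<longlongrightarrow> a + b) F" if "(g \<longlongrightarrow> b) F"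
    by (rule frechet_tendsto_add[OF fre f that])
  show "((\<lambda>t. f t * g t) \<longlongrightarrow> a * b) F" if "(g \<longlongrightarrow> b) F"
    by (rule tendsto_continuous_binop[OF mul f that])
  show "((\<lambda>t. r t *\<^sub>R f t) \<longlongrightarrow> k *\<^sub>R a) F" if "(r \<longlongrightarrow> k) F"
    using tendsto_continuous_binop[OF scale tendsto_of_real[OF that] f] real by simp
qed

section \<open>Limits of vectors, along lines and under the Minkowski form\<close>

context topological_real_algebra
begin

lemma tendsto_vec_plus:
  fixes f g :: "real \<Rightarrow> 'a^'n::finite"
  assumes "(f \<longlongrightarrow> a) F" "(g \<longlongrightarrow> b) F"
  shows "((\<lambda>t. f t + g t) \<longlongrightarrow> a + b) F"
  by (rule vec_tendstoI) (simp add: tendsto_plus tendsto_vec_nth assms)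

lemma tendsto_vec_scale:
  fixes f :: "real \<Rightarrow> 'a^'n::finite"
  assumes "(r \<longlongrightarrow> k) F" "(f \<longlongrightarrow> a) F"
  shows "((\<lambda>t. r t *\<^sub>R f t) \<longlongrightarrow> k *\<^sub>R a) F"
  by (rule vec_tendstoI) (simp add: tendsto_real_scale tendsto_vec_nth assms)

lemma tendsto_line:
  fixes x u :: "'a^'n::finite"
  shows "((\<lambda>t::real. x + t *\<^sub>R u) \<longlongrightarrow> x) (at 0)"
proof -
  have "((\<lambda>t::real. x + t *\<^sub>R u) \<longlongrightarrow> x + 0 *\<^sub>R u) (at 0)"
    by (intro tendsto_vec_plus tendsto_vec_scale tendsto_const tendsto_ident_at)
  then show ?thesis by simp
qed

lemma eventually_line:
  fixes x u :: "'a^'n::finite"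
  assumes "open S" "x \<in> S"
  shows "\<forall>\<^sub>F t in at (0::real). x + t *\<^sub>R u \<in> S"
  using topological_tendstoD[OF tendsto_line assms] .

lemma tendsto_finite_sum:
  fixes f :: "'i \<Rightarrow> real \<Rightarrow> 'a"
  assumes "\<And>i. i \<in> I \<Longrightarrow> (f i \<longlongrightarrow> l i) F"
  shows "((\<lambda>t. \<Sum>i\<in>I. f i t) \<longlongrightarrow> (\<Sum>i\<in>I. l i)) F"
  using assms by (induction I rule: infinite_finite_induct) (simp_all add: tendsto_plus)

lemma tendsto_mink_form:
  fixes f g :: "real \<Rightarrow> 'a^4"
  assumes "(f \<longlongrightarrow> a) F" "(g \<longlongrightarrow> b) F"
  shows "((\<lambda>t. mink_form (f t) (g t)) \<longlongrightarrow> mink_form a b) F"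
  unfolding mink_form_def
  by (intro tendsto_finite_sum tendsto_real_scale tendsto_const tendsto_times tendsto_vec_nth assms)

end

section \<open>Algebra of the Minkowski form\<close>

lemma mink_form_diff_left: "mink_form (x - x') y = mink_form x y - mink_form x' y"
  by (simp add: mink_form_def algebra_simps sum_subtractf)

lemma mink_form_diff_right: "mink_form x (y - y') = mink_form x y - mink_form x y'"
  by (simp add: mink_form_def algebra_simps sum_subtractf)

lemma mink_form_scale_left: "mink_form (r *\<^sub>R x) y = r *\<^sub>R mink_form x y"
  by (simp add: mink_form_def scaleR_sum_right mult.commute[of r])

lemma mink_form_scale_right: "mink_form x (r *\<^sub>R y) = r *\<^sub>R mink_form x y"
  by (simp add: mink_form_def scaleR_sum_right mult.commute[of r])

lemma center_left_commute:
  assumes "z \<in> center"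
  shows "x * (z * y) = z * (x * y)"
proof -
  have "z * x = x * z" using assms by (simp add: center_def)
  then show ?thesis by (simp add: mult.assoc[symmetric])
qed

text \<open>The entries of \<open>B\<close> already stand to the left of \<open>x$a * y$b\<close>,
  so regrouping the sums exhibits the coefficient of each product.\<close>

lemma mink_form_matrix_left:
  fixes B :: "'a::real_algebra_1^4^4"
  shows "mink_form (B *v x) y =
    (\<Sum>a\<in>UNIV. \<Sum>b\<in>UNIV. (\<Sum>c\<in>UNIV. eta c b *\<^sub>R B$c$a) * (x$a * y$b))"
proof -
  have "mink_form (B *v x) y = (\<Sum>c\<in>UNIV. \<Sum>b\<in>UNIV. \<Sum>a\<in>UNIV. eta c b *\<^sub>R (B$c$a * (x$a * y$b)))"
    by (simp add: mink_form_def matrix_vector_mult_def sum_distrib_right scaleR_sum_right mult.assoc)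
  also have "\<dots> = (\<Sum>b\<in>UNIV. \<Sum>c\<in>UNIV. \<Sum>a\<in>UNIV. eta c b *\<^sub>R (B$c$a * (x$a * y$b)))"
    by (rule sum.swap)
  also have "\<dots> = (\<Sum>b\<in>UNIV. \<Sum>a\<in>UNIV. \<Sum>c\<in>UNIV. eta c b *\<^sub>R (B$c$a * (x$a * y$b)))"
    by (rule sum.cong[OF refl], rule sum.swap)
  also have "\<dots> = (\<Sum>a\<in>UNIV. \<Sum>b\<in>UNIV. \<Sum>c\<in>UNIV. eta c b *\<^sub>R (B$c$a * (x$a * y$b)))"
    by (rule sum.swap)
  finally show ?thesis by (simp add: sum_distrib_right)
qed

text \<open>Here the entries of \<open>B\<close> must pass the components of \<open>x\<close>, which
  centrality allows.\<close>

lemma mink_form_central_matrix_right: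
  fixes B :: "'a::real_algebra_1^4^4"
  assumes "\<And>a b. B$a$b \<in> center"
  shows "mink_form x (B *v y) =
    (\<Sum>a\<in>UNIV. \<Sum>b\<in>UNIV. (\<Sum>c\<in>UNIV. eta a c *\<^sub>R B$c$b) * (x$a * y$b))"
proof -
  have comm: "x$a * (B$c$b * y$b) = B$c$b * (x$a * y$b)" for a b c
    by (rule center_left_commute[OF assms])
  have "mink_form x (B *v y) = (\<Sum>a\<in>UNIV. \<Sum>c\<in>UNIV. \<Sum>b\<in>UNIV. eta a c *\<^sub>R (B$c$b * (x$a * y$b)))"
    by (simp add: mink_form_def matrix_vector_mult_def sum_distrib_left scaleR_sum_right comm)
  also have "\<dots> = (\<Sum>a\<in>UNIV. \<Sum>b\<in>UNIV. \<Sum>c\<in>UNIV. eta a c *\<^sub>R (B$c$b * (x$a * y$b)))"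
    by (rule sum.cong[OF refl], rule sum.swap)
  finally show ?thesis by (simp add: sum_distrib_right)
qed

text \<open>The coefficient of \<open>y$a * y'$b\<close> in the sum is exactly the left side of the
  defining relation of \<open>so13\<close>.\<close>

lemma so13_skew:
  assumes "X \<in> so13"
  shows "mink_form (X y) y' + mink_form y (X y') = 0"
proof -
  obtain B where X: "X = (*v) B" and cen: "\<And>a b. B$a$b \<in> center"
    and skew: "\<And>a b. (\<Sum>c\<in>UNIV. eta c b *\<^sub>R (B$c$a) + eta a c *\<^sub>R (B$c$b)) = 0"
    using assms unfolding so13_def by blast
  have "mink_form (X y) y' + mink_form y (X y') =
      (\<Sum>a\<in>UNIV. \<Sum>b\<in>UNIV. (\<Sum>c\<in>UNIV. eta c b *\<^sub>R (B$c$a) + eta a c *\<^sub>R (B$c$b)) * (y$a * y'$b))"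
    unfolding X mink_form_matrix_left mink_form_central_matrix_right[OF cen]
    by (simp only: sum.distrib distrib_right)
  then show ?thesis by (simp add: skew)
qed

text \<open>Once the central entries of \<open>L\<close> are moved to the front, the coefficient of
  \<open>y$a * y'$b\<close> is the \<open>(a, b)\<close> entry of the transpose of \<open>L\<close>
  times \<open>eta\<close> times \<open>L\<close>, which is \<open>eta\<close>.\<close>

lemma SO13_preserves_mink_form:
  assumes "T \<in> SO13"
  shows "mink_form (T y) (T y') = mink_form y y'"
proof -
  obtain L where T: "T = (*v) L" and cen: "\<And>a b. L$a$b \<in> center"
    and orth: "\<And>a b. (\<Sum>c\<in>UNIV. \<Sum>d\<in>UNIV. eta c d *\<^sub>R (L$c$a * L$d$b)) = of_real (eta a b)"
    using assms unfolding SO13_def by blast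
  have "mink_form (T y) (T y') =
     (\<Sum>a\<in>UNIV. \<Sum>d\<in>UNIV. (\<Sum>c\<in>UNIV. eta c d *\<^sub>R L$c$a) * (y$a * (\<Sum>b\<in>UNIV. L$d$b * y'$b)))"
    unfolding T mink_form_matrix_left by (simp add: matrix_vector_mult_def)
  also have "\<dots> = (\<Sum>a\<in>UNIV. \<Sum>d\<in>UNIV. \<Sum>b\<in>UNIV. \<Sum>c\<in>UNIV.
      (eta c d *\<^sub>R (L$c$a * L$d$b)) * (y$a * y'$b))"
  proof (intro sum.cong refl)
    fix a d
    have c: "y$a * (L$d$b * y'$b) = L$d$b * (y$a * y'$b)" for b
      by (rule center_left_commute[OF cen])
    show "(\<Sum>c\<in>UNIV. eta c d *\<^sub>R L$c$a) * (y$a * (\<Sum>b\<in>UNIV. L$d$b * y'$b)) =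
      (\<Sum>b\<in>UNIV. \<Sum>c\<in>UNIV. (eta c d *\<^sub>R (L$c$a * L$d$b)) * (y$a * y'$b))"
      by (simp add: sum_distrib_left sum_distrib_right c mult.assoc)
  qed
  also have "\<dots> = (\<Sum>a\<in>UNIV. \<Sum>b\<in>UNIV. \<Sum>d\<in>UNIV. \<Sum>c\<in>UNIV.
      (eta c d *\<^sub>R (L$c$a * L$d$b)) * (y$a * y'$b))"
    by (rule sum.cong[OF refl], rule sum.swap)
  also have "\<dots> = (\<Sum>a\<in>UNIV. \<Sum>b\<in>UNIV. \<Sum>c\<in>UNIV. \<Sum>d\<in>UNIV.
      (eta c d *\<^sub>R (L$c$a * L$d$b)) * (y$a * y'$b))"
    by (rule sum.cong[OF refl], rule sum.cong[OF refl], rule sum.swap)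
  also have "\<dots> = (\<Sum>a\<in>UNIV. \<Sum>b\<in>UNIV. of_real (eta a b) * (y$a * y'$b))"
    by (simp only: sum_distrib_right[symmetric] orth)
  also have "\<dots> = mink_form y y'"
    by (simp add: mink_form_def scaleR_conv_of_real)
  finally show ?thesis .
qed

lemma cdet4_mat_1: "cdet4 (mat 1 :: 'a::real_algebra_1^4^4) = 1"
proof -
  let ?t = "\<lambda>\<sigma>::4 \<Rightarrow> 4. of_int (sign \<sigma>) * ((mat 1 :: 'a^4^4) $ 0 $ \<sigma> 0 * mat 1 $ 1 $ \<sigma> 1
      * mat 1 $ 2 $ \<sigma> 2 * mat 1 $ 3 $ \<sigma> 3)"
  have "?t \<sigma> = 0" if nid: "\<sigma> \<noteq> id" for \<sigma>
  proof -
    obtain i where "\<sigma> i \<noteq> i" using nid unfolding fun_eq_iff id_def by blast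
    \<comment> \<open>In the type \<open>4\<close> the numeral 4 equals 0, so the four rows used by
      \<open>cdet4\<close> exhaust the index type and an off-diagonal factor 0 occurs.\<close>
    moreover have "i = 0 \<or> i = 1 \<or> i = 2 \<or> i = 3" using exhaust_4[of i] by auto
    ultimately show ?thesis by (auto simp: mat_def)
  qed
  then have "(\<Sum>\<sigma> | \<sigma> permutes UNIV. ?t \<sigma>) = (\<Sum>\<sigma>\<in>{id}. ?t \<sigma>)"
    by (intro sum.mono_neutral_right) (auto simp: permutes_id)
  then show ?thesis by (simp add: cdet4_def mat_def)
qed

text \<open>Ensures that a frame lies in its own coset, so that the choice in
  \<open>coset_metric\<close> is made from a nonempty set.\<close>

lemma id_in_SO13: "id \<in> SO13"
proof -
  have "id \<in> GL4" by (simp add: GL4_def zlinear_def continuous_on_id[unfolded id_def[symmetric]])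
  moreover have "id = (*v) (mat 1 :: 'a^4^4)" by (rule ext) simp
  moreover have "(\<Sum>c\<in>UNIV. \<Sum>d\<in>UNIV. eta c d *\<^sub>R ((mat 1 :: 'a^4^4)$c$a * (mat 1 :: 'a^4^4)$d$b))
      = of_real (eta a b)" for a b
  proof -
    have "(\<Sum>c\<in>UNIV. \<Sum>d\<in>UNIV. eta c d *\<^sub>R ((mat 1 :: 'a^4^4)$c$a * (mat 1 :: 'a^4^4)$d$b))
      = (\<Sum>c\<in>UNIV. if c = a then (\<Sum>d\<in>UNIV. if d = b then of_real (eta c d) else 0) else 0)"
      by (intro sum.cong refl)
        (auto simp: mat_def scaleR_conv_of_real if_distrib cong: if_cong)
    then show ?thesis by simp
  qed
  moreover have "(mat 1 :: 'a^4^4)$a$b \<in> center" for a b by (simp add: mat_def center_def)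
  ultimately show ?thesis
    unfolding SO13_def using cdet4_mat_1 by blast
qed

section \<open>Weak derivatives\<close>

lemma wder_eqI:
  fixes f :: "'e::real_vector \<Rightarrow> 'f::{real_vector,t2_space}"
  assumes "wder_exists f x v L"
  shows "wder f x v = L"
  unfolding wder_def
proof (rule the_equality)
  fix L' assume "wder_exists f x v L'"
  with assms show "L' = L" unfolding wder_exists_def by (auto intro: tendsto_unique[rotated])
qed (fact assms)

text \<open>The library makes \<open>'f^'n\<close> a Hausdorff space only for metric \<open>'f\<close>.\<close>

lemma wder_vec_eqI:
  fixes f :: "'e::real_vector \<Rightarrow> 'f::{real_vector,t2_space}^'n::finite"
  assumes "wder_exists f x v L"
  shows "wder f x v = L"
  unfolding wder_def
proof (rule the_equality)
  fix L' assume "wder_exists f x v L'"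
  then have lim: "((\<lambda>t::real. (1 / t) *\<^sub>R (f (x + t *\<^sub>R v) - f x)) \<longlongrightarrow> L') (at 0)"
    "((\<lambda>t::real. (1 / t) *\<^sub>R (f (x + t *\<^sub>R v) - f x)) \<longlongrightarrow> L) (at 0)"
    using assms by (simp_all only: wder_exists_def)
  have "L' $ i = L $ i" for i
    by (rule tendsto_unique[OF _ lim[THEN tendsto_vec_nth]]) simp
  then show "L' = L" by (simp add: vec_eq_iff)
qed (fact assms)

lemma wsmooth_open: "wsmooth U f \<Longrightarrow> open U"
  by (simp add: wsmooth_def)

lemma wsmooth_wder_exists:
  assumes "wsmooth U f" "x \<in> U"
  shows "\<exists>L. wder_exists f x u L"
proof -
  have "\<forall>k v u. \<forall>x\<in>U. \<exists>L. wder_exists (wderiv k f v) x u L"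
    using assms(1) by (simp add: wsmooth_def)
  from this[rule_format, OF assms(2), of 0 "\<lambda>_. u" u] show ?thesis by simp
qed

lemma wsmooth_continuous_on:
  fixes f :: "'a::{real_vector,topological_space} \<Rightarrow> 'b::{real_vector,topological_space}"
  assumes "wsmooth U f"
  shows "continuous_on U f"
proof -
  have "continuous_on (U \<times> UNIV) (\<lambda>(x, v). wderiv 0 f v x)"
    using assms unfolding wsmooth_def by blast
  \<comment> \<open>The zeroth derivative ignores the directions, so any constant sequence of
    directions may be inserted.\<close>
  moreover have "continuous_on U (\<lambda>x. (x, \<lambda>_::nat. undefined :: 'a))"
    by (intro continuous_on_Pair continuous_on_id continuous_on_const)
  ultimately have "continuous_on U (\<lambda>x. case (x, \<lambda>_::nat. undefined :: 'a) of (x, v) \<Rightarrow> wderiv 0 f v x)"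
    by (rule continuous_on_compose2) auto
  then show ?thesis by simp
qed

section \<open>Product rules for weak derivatives\<close>

context topological_real_algebra
begin

lemma wder_eq_0_of_locally_constant:
  fixes f :: "'a^4 \<Rightarrow> 'b::{real_vector,t2_space}"
  assumes "open S" "x \<in> S" "\<And>y. y \<in> S \<Longrightarrow> f y = k"
  shows "wder f x u = 0"
proof (rule wder_eqI)
  have "\<forall>\<^sub>F t in at (0::real). (1 / t) *\<^sub>R (f (x + t *\<^sub>R u) - f x) = 0"
    using eventually_line[OF assms(1,2), of u] by eventually_elim (simp add: assms)
  then show "wder_exists f x u 0"
    unfolding wder_exists_def by (rule tendsto_eventually)
qed

text \<open>The Leibniz rule for a bilinear form: the difference quotient splits into one term with
  the quotient of \<open>f\<close> and one with the quotient of \<open>g\<close>, keeping the order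
  of the factors.\<close>

lemma wder_exists_mink_form:
  fixes f g :: "'a^4 \<Rightarrow> 'a^4"
  assumes f: "wder_exists f x u a" and g: "wder_exists g x u b"
  shows "wder_exists (\<lambda>x. mink_form (f x) (g x)) x u (mink_form a (g x) + mink_form (f x) b)"
proof -
  let ?df = "\<lambda>t::real. (1 / t) *\<^sub>R (f (x + t *\<^sub>R u) - f x)"
  let ?dg = "\<lambda>t::real. (1 / t) *\<^sub>R (g (x + t *\<^sub>R u) - g x)"
  have df: "(?df \<longlongrightarrow> a) (at 0)" and dg: "(?dg \<longlongrightarrow> b) (at 0)"
    using f g by (simp_all add: wder_exists_def)
  \<comment> \<open>For \<open>t\<close> other than 0 this is \<open>g\<close> at the moved point;
    written this way, its convergence follows from the weak derivative of \<open>g\<close>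
    alone.\<close>
  have "((\<lambda>t. g x + t *\<^sub>R ?dg t) \<longlongrightarrow> g x + 0 *\<^sub>R b) (at 0)"
    by (intro tendsto_vec_plus tendsto_vec_scale tendsto_const tendsto_ident_at dg)
  then have "((\<lambda>t. mink_form (?df t) (g x + t *\<^sub>R ?dg t) + mink_form (f x) (?dg t)) \<longlongrightarrow>
      mink_form a (g x) + mink_form (f x) b) (at 0)"
    by (intro tendsto_plus tendsto_mink_form tendsto_const df dg) simp
  moreover have "\<forall>\<^sub>F t in at (0::real).
      mink_form (?df t) (g x + t *\<^sub>R ?dg t) + mink_form (f x) (?dg t) =
      (1 / t) *\<^sub>R (mink_form (f (x + t *\<^sub>R u)) (g (x + t *\<^sub>R u)) - mink_form (f x) (g x))"
    by (auto simp: eventually_at_filter mink_form_scale_left mink_form_scale_right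
        mink_form_diff_left mink_form_diff_right scaleR_diff_right)
  ultimately show ?thesis
    unfolding wder_exists_def by (rule Lim_transform_eventually)
qed

text \<open>A map that is additive and homogeneous in the second argument can be differentiated along a
  curve \<open>(x + tu, \<sigma> (x + tu))\<close> from a partial derivative and joint continuity alone, so no chain rule
  for weak derivatives is needed.\<close>

lemma wder_exists_fibrewise_linear:
  fixes F :: "('a^4) \<times> ('a^4) \<Rightarrow> 'a^'n::finite" and \<sigma> :: "'a^4 \<Rightarrow> 'a^4"
  assumes S: "open S" "x \<in> S"
    and add: "\<And>z a b. z \<in> S \<Longrightarrow> F (z, a + b) = F (z, a) + F (z, b)"
    and scale: "\<And>z r a. z \<in> S \<Longrightarrow> F (z, r *\<^sub>R a) = r *\<^sub>R F (z, a)"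
    and cont: "continuous_on (S \<times> UNIV) F"
    and dF: "wder_exists F (x, \<sigma> x) (u, 0) L"
    and d\<sigma>: "wder_exists \<sigma> x u D"
  shows "wder_exists (\<lambda>z. F (z, \<sigma> z)) x u (L + F (x, D))"
proof -
  let ?d = "\<lambda>t::real. (1 / t) *\<^sub>R (\<sigma> (x + t *\<^sub>R u) - \<sigma> x)"
  have d: "(?d \<longlongrightarrow> D) (at 0)" using d\<sigma> by (simp add: wder_exists_def)
  have "\<forall>\<^sub>F t in at 0. (x + t *\<^sub>R u, ?d t) \<in> S \<times> UNIV"
    using eventually_line[OF S, of u] by eventually_elim simp
  from continuous_on_tendsto_compose[OF cont tendsto_Pair[OF tendsto_line[of x u] d] _ this] S
  have "((\<lambda>t. F (x + t *\<^sub>R u, ?d t)) \<longlongrightarrow> F (x, D)) (at 0)" by simp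
  moreover have "((\<lambda>t. (1 / t) *\<^sub>R (F (x + t *\<^sub>R u, \<sigma> x) - F (x, \<sigma> x))) \<longlongrightarrow> L) (at 0)"
    using dF by (simp add: wder_exists_def)
  ultimately have "((\<lambda>t. (1 / t) *\<^sub>R (F (x + t *\<^sub>R u, \<sigma> x) - F (x, \<sigma> x)) + F (x + t *\<^sub>R u, ?d t))
      \<longlongrightarrow> L + F (x, D)) (at 0)"
    by (intro tendsto_vec_plus)
  \<comment> \<open>Additivity turns the change in the second argument into the value of
    \<open>F\<close> on the increment of \<open>\<sigma>\<close>, and homogeneity moves the factor
    \<open>1 / t\<close> inside.\<close>
  moreover have "\<forall>\<^sub>F t in at (0::real).
      (1 / t) *\<^sub>R (F (x + t *\<^sub>R u, \<sigma> x) - F (x, \<sigma> x)) + F (x + t *\<^sub>R u, ?d t) =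
      (1 / t) *\<^sub>R (F (x + t *\<^sub>R u, \<sigma> (x + t *\<^sub>R u)) - F (x, \<sigma> x))"
    using eventually_line[OF S, of u]
  proof eventually_elim
    case (elim t)
    have "F (x + t *\<^sub>R u, \<sigma> x + (\<sigma> (x + t *\<^sub>R u) - \<sigma> x)) =
        F (x + t *\<^sub>R u, \<sigma> x) + F (x + t *\<^sub>R u, \<sigma> (x + t *\<^sub>R u) - \<sigma> x)"
      by (rule add[OF elim])
    then show ?case
      by (simp add: scale[OF elim] scaleR_diff_right[symmetric] scaleR_add_right[symmetric])
  qed
  ultimately show ?thesis
    unfolding wder_exists_def by (rule Lim_transform_eventually)
qed

end

section \<open>Frames and the vierbein\<close>

lemma zero_in_center: "0 \<in> center" by (simp add: center_def)

text \<open>Real scalars are central, hence linearity over the center includes real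
  homogeneity.\<close>

lemma of_real_in_center: "of_real r \<in> (center :: 'a::real_algebra_1 set)"
  by (simp add: center_def Reals_def of_real_def)

lemma of_real_vector_scale: "(of_real r :: 'a::real_algebra_1) *s (x :: 'a^'n) = r *\<^sub>R x"
  by (simp add: vec_eq_iff) (simp add: scaleR_conv_of_real)

text \<open>The transformation law recovers a tangent vector from its coordinates in a single
  chart.\<close>

lemma tangent_eq_tvec_of:
  assumes "v \<in> tangent_space At p" "c \<in> charts_at At p"
  shows "v = tvec_of At c p (v c)"
proof
  fix d show "v d = tvec_of At c p (v c) d"
  proof (cases "d \<in> charts_at At p")
    case True
    have "v d = wder (cmap d \<circ> cinv c) (cmap c p) (v c)"
      using assms True unfolding tangent_space_def by blast
    then show ?thesis using True by (simp add: tvec_of_def)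
  next
    case False
    have "v d = 0" using assms(1) False unfolding tangent_space_def by blast
    then show ?thesis using False by (simp add: tvec_of_def)
  qed
qed

text \<open>In one chart the frame is an automorphism of \<open>A^4\<close>, and equality in one
  chart forces equality of tangent vectors.\<close>

lemma frame_surj:
  assumes "u \<in> frame_bundle At p" "c \<in> charts_at At p" "w \<in> tangent_space At p"
  shows "\<exists>y. u y = w"
proof -
  have "surj (\<lambda>y. u y c)" using assms(1,2) by (auto simp: frame_bundle_def GL4_def bij_def)
  then obtain y where y: "w c = u y c" by (meson surjD)
  have "u y \<in> tangent_space At p" using assms(1) by (simp add: frame_bundle_def)
  from tangent_eq_tvec_of[OF this assms(2)] tangent_eq_tvec_of[OF assms(3,2)] y
  show ?thesis by metis
qed

lemma frame_inj:
  assumes "u \<in> frame_bundle At p" "c \<in> charts_at At p"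
  shows "inj u"
proof -
  have "inj (\<lambda>y. u y c)" using assms by (auto simp: frame_bundle_def GL4_def bij_def)
  then show ?thesis by (metis (mono_tags, lifting) injD injI)
qed

text \<open>The frame attains the coordinates \<open>w\<close> in chart \<open>c\<close>, and the
  tangent vector it yields is \<open>tvec_of At c p w\<close>. This replaces the chain rule for
  transition maps.\<close>

lemma tvec_of_tangent:
  assumes "u \<in> frame_bundle At p" "c \<in> charts_at At p"
  shows "tvec_of At c p w \<in> tangent_space At p"
proof -
  have "surj (\<lambda>y. u y c)" using assms by (auto simp: frame_bundle_def GL4_def bij_def)
  then obtain y where y: "w = u y c" by (meson surjD)
  have "u y \<in> tangent_space At p" using assms(1) by (simp add: frame_bundle_def)
  with tangent_eq_tvec_of[OF this assms(2)] y show ?thesis by metis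
qed

section \<open>Tangent vectors and local sections in charts\<close>

lemma charts_at_nonempty:
  assumes "quantum_manifold At"
  shows "\<exists>c. c \<in> charts_at At p"
  using assms unfolding quantum_manifold_def charts_at_def by blast

lemma transition_zlinear:
  assumes "quantum_manifold At" "c \<in> charts_at At p" "d \<in> charts_at At p"
  shows "zlinear (*s) (*s) (wder (cmap d \<circ> cinv c) (cmap c p))"
  using assms unfolding quantum_manifold_def qsmooth_def charts_at_def by blast

lemma tvec_of_add:
  assumes "quantum_manifold At" "c \<in> charts_at At p"
  shows "tvec_of At c p (a + b) = tadd (tvec_of At c p a) (tvec_of At c p b)"
  using transition_zlinear[OF assms] unfolding tvec_of_def tadd_def zlinear_def by (intro ext) auto

lemma tvec_of_scale:
  assumes "quantum_manifold At" "c \<in> charts_at At p" "z \<in> center"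
  shows "tvec_of At c p (z *s a) = tscale z (tvec_of At c p a)"
  using transition_zlinear[OF assms(1,2)] assms(3) unfolding tvec_of_def tscale_def zlinear_def
  by (intro ext) auto

lemma cinv_cmap:
  assumes "quantum_manifold At" "c \<in> At" "q \<in> cdom c"
  shows "cinv c (cmap c q) = q"
  using assms unfolding quantum_manifold_def homeomorphism_def by blast

text \<open>Smoothness of the section on the product with \<open>UNIV\<close> includes openness of
  that product, and projections are open.\<close>

lemma local_section_open_image:
  assumes "local_section At Q U s" "c \<in> At"
  shows "open (cmap c ` (U \<inter> cdom c))"
proof -
  have "wsmooth (cmap c ` (U \<inter> cdom c) \<times> UNIV) (\<lambda>(x, y). s (cinv c x) y c)"
    using assms unfolding local_section_def qsmooth_def by blast
  from open_image_fst[OF wsmooth_open[OF this]] show ?thesis by simp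
qed

text \<open>In a chart this function is the field \<open>F\<close>, linear in the fibre, evaluated
  along the coordinates \<open>\<sigma>\<close> of a frame vector. Existence matters because
  \<open>dir_deriv\<close> by itself only names a value.\<close>

lemma (in topological_real_algebra) vierbein_frame_wder_exists:
  fixes At :: "('m::t2_space, 'a) chart set" and \<mu> :: "'m \<Rightarrow> ('m, 'a) tvec \<Rightarrow> 'a^'i::finite"
  assumes man: "quantum_manifold At" and hom: "hom_section At \<mu>"
    and s: "local_section At (frame_bundle At) U s" "p \<in> U" and c: "c \<in> charts_at At p"
  shows "\<exists>L. wder_exists (\<lambda>x. vierbein iv \<mu> (cinv c x) (s (cinv c x) y)) (cmap c p) u L"
proof -
  define S where "S = cmap c ` (U \<inter> cdom c)"
  define F where "F = (\<lambda>(x, w). \<mu> (cinv c x) (tvec_of At c (cinv c x) w))"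
  define \<sigma> where "\<sigma> = (\<lambda>x. s (cinv c x) y c)"
  let ?x = "cmap c p"
  have cAt: "c \<in> At" "p \<in> cdom c" using c by (auto simp: charts_at_def)
  have S: "open S" "?x \<in> S"
    using local_section_open_image[OF s(1) cAt(1)] s(2) cAt(2) by (auto simp: S_def)
  have inS: "cinv c x \<in> U" "c \<in> charts_at At (cinv c x)" "s (cinv c x) \<in> frame_bundle At (cinv c x)"
    if "x \<in> S" for x
    using that cinv_cmap[OF man cAt(1)] cAt s(1) unfolding S_def charts_at_def local_section_def
    by auto
  have SF: "wsmooth (cmap c ` cdom c \<times> UNIV) F"
    using hom cAt unfolding hom_section_def qsmooth_def F_def by blast
  have S\<sigma>: "wsmooth (S \<times> UNIV) (\<lambda>(x, y). s (cinv c x) y c)"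
    using s(1) cAt unfolding local_section_def qsmooth_def S_def by blast
  \<comment> \<open>The direction \<open>(u, 0)\<close> moves the base point and keeps the vector
    \<open>y\<close> fixed.\<close>
  obtain D0 where "wder_exists (\<lambda>(x, y). s (cinv c x) y c) (?x, y) (u, 0) D0"
    using wsmooth_wder_exists[OF S\<sigma>, of "(?x, y)"] S by auto
  then have D: "wder_exists \<sigma> ?x u D0" by (simp add: wder_exists_def \<sigma>_def)
  obtain L0 where L: "wder_exists F (?x, \<sigma> ?x) (u, 0) L0"
    using wsmooth_wder_exists[OF SF, of "(?x, \<sigma> ?x)"] cAt by auto
  have add: "F (z, a + b) = F (z, a) + F (z, b)" if "z \<in> S" for z a b
    using hom tvec_of_tangent[OF inS(3,2)[OF that]] unfolding hom_section_def F_def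
    by (simp add: tvec_of_add[OF man inS(2)[OF that]])
  have scale: "F (z, r *\<^sub>R a) = r *\<^sub>R F (z, a)" if "z \<in> S" for z r a
  proof -
    have "\<mu> (cinv c z) (tscale (of_real r) (tvec_of At c (cinv c z) a)) =
        of_real r *s \<mu> (cinv c z) (tvec_of At c (cinv c z) a)"
      using hom tvec_of_tangent[OF inS(3,2)[OF that]] of_real_in_center[of r]
      unfolding hom_section_def by blast
    then show ?thesis
      using tvec_of_scale[OF man inS(2)[OF that] of_real_in_center, of r a]
      by (simp add: F_def of_real_vector_scale)
  qed
  have cont: "continuous_on (S \<times> UNIV) F"
    by (rule continuous_on_subset[OF wsmooth_continuous_on[OF SF]]) (auto simp: S_def)
  from wder_exists_fibrewise_linear[of S ?x F \<sigma>, OF S add scale cont L D]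
  have lim: "wder_exists (\<lambda>z. F (z, \<sigma> z)) ?x u (L0 + F (?x, D0))" .
  have eq: "vierbein iv \<mu> (cinv c z) (s (cinv c z) y) = vector_part iv (F (z, \<sigma> z))"
    if "z \<in> S" for z
  proof -
    have "s (cinv c z) y \<in> tangent_space At (cinv c z)"
      using inS(3)[OF that] by (simp add: frame_bundle_def)
    from tangent_eq_tvec_of[OF this inS(2)[OF that]] show ?thesis
      by (simp add: vierbein_def F_def \<sigma>_def)
  qed
  \<comment> \<open>\<open>vector_part\<close> only selects components, so it commutes with the
    limit and with the difference quotient.\<close>
  have "((\<lambda>t::real. vector_part iv ((1 / t) *\<^sub>R (F (?x + t *\<^sub>R u, \<sigma> (?x + t *\<^sub>R u)) - F (?x, \<sigma> ?x))))
     \<longlongrightarrow> vector_part iv (L0 + F (?x, D0))) (at 0)"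
    unfolding vector_part_def
    by (intro tendsto_vec_lambda tendsto_vec_nth lim[unfolded wder_exists_def])
  moreover have "\<forall>\<^sub>F t in at (0::real).
      vector_part iv ((1 / t) *\<^sub>R (F (?x + t *\<^sub>R u, \<sigma> (?x + t *\<^sub>R u)) - F (?x, \<sigma> ?x))) =
      (1 / t) *\<^sub>R (vierbein iv \<mu> (cinv c (?x + t *\<^sub>R u)) (s (cinv c (?x + t *\<^sub>R u)) y) -
        vierbein iv \<mu> (cinv c ?x) (s (cinv c ?x) y))"
    using eventually_line[OF S, of u]
    by eventually_elim (simp add: eq S vector_part_def vec_eq_iff)
  ultimately show ?thesis
    unfolding wder_exists_def by (blast intro: Lim_transform_eventually)
qed

section \<open>Metricity\<close>

text \<open>Since the Lorentz part of the field need not have central entries, it does not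
  preserve the Minkowski form automatically; the following defect measures the failure.\<close>

definition lorentz_defect ::
  "(4 \<Rightarrow> 'i) \<Rightarrow> (4 \<Rightarrow> 4 \<Rightarrow> 'i) \<Rightarrow> ('m \<Rightarrow> ('m, 'a) tvec \<Rightarrow> 'a::real_algebra_1^'i) \<Rightarrow>
    'm \<Rightarrow> ('m, 'a) tvec \<Rightarrow> ('m, 'a) tvec \<Rightarrow> ('m, 'a) tvec \<Rightarrow> 'a" where
  "lorentz_defect iv il \<mu> p v w w' =
     mink_form (lorentz_part il (\<mu> p v) *v vierbein iv \<mu> p w) (vierbein iv \<mu> p w') +
     mink_form (vierbein iv \<mu> p w) (lorentz_part il (\<mu> p v) *v vierbein iv \<mu> p w')"

text \<open>By the gauge rule, the derivative of the vierbein on a frame vector is a connection term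
  minus a Lorentz term. In the Leibniz rule the connection terms cancel those subtracted by the
  covariant derivative, and the Lorentz terms remain.\<close>

lemma (in topological_real_algebra) cov_deriv_metric_eq_defect:
  fixes At :: "('m::t2_space, 'a) chart set" and \<mu> :: "'m \<Rightarrow> ('m, 'a) tvec \<Rightarrow> 'a^'i::finite"
  assumes man: "quantum_manifold At" and hom: "hom_section At \<mu>"
    and lc: "levi_civita_belonging At iv il \<mu> \<omega>"
    and s: "local_section At (frame_bundle At) U s" "p \<in> U"
    and v: "v \<in> tangent_space At p" and w: "w \<in> tangent_space At p" "w' \<in> tangent_space At p"
  shows "cov_deriv_bilinear At \<omega> s (quantum_metric iv \<mu>) p v w w' =
    - lorentz_defect iv il \<mu> p v w w'"
proof -
  \<comment> \<open>The same choice as in \<open>dir_deriv\<close>, so directional derivatives at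
    \<open>p\<close> unfold to weak derivatives in this chart.\<close>
  define c where "c = (SOME c. c \<in> charts_at At p)"
  have c: "c \<in> charts_at At p"
    unfolding c_def using charts_at_nonempty[OF man] by (rule someI_ex)
  then have pc: "cinv c (cmap c p) = p" using cinv_cmap[OF man] by (auto simp: charts_at_def)
  have fr: "s p \<in> frame_bundle At p" using s by (auto simp: local_section_def)
  let ?\<theta> = "vierbein iv \<mu>"
  let ?M = "lorentz_part il (\<mu> p v)"
  let ?X = "\<omega> p (s p) (pushforward At s p v)"
  define y y' where "y = inv_into UNIV (s p) w" and "y' = inv_into UNIV (s p) w'"
  have sy: "s p y = w" "s p y' = w'"
    using frame_surj[OF fr c] w unfolding y_def y'_def by (metis f_inv_into_f rangeI)+
  define D where "D = (\<lambda>z. dir_deriv At (\<lambda>q. ?\<theta> q (s q z)) p v)"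
  have D: "D z = ?\<theta> p (s p (?X z)) - ?M *v ?\<theta> p (s p z)" for z
    using lc s v unfolding levi_civita_belonging_def D_def by (auto simp: algebra_simps)
  \<comment> \<open>The existing derivative is unique, so the value \<open>D z\<close> given by the
    gauge rule is a genuine limit to which the Leibniz rule applies.\<close>
  have ex: "wder_exists (\<lambda>x. ?\<theta> (cinv c x) (s (cinv c x) z)) (cmap c p) (v c) (D z)" for z
  proof -
    obtain L where L: "wder_exists (\<lambda>x. ?\<theta> (cinv c x) (s (cinv c x) z)) (cmap c p) (v c) L"
      using vierbein_frame_wder_exists[OF man hom s c] by blast
    then have "D z = L"
      using wder_vec_eqI[OF L] by (simp add: D_def dir_deriv_def c_def[symmetric] o_def)
    with L show ?thesis by simp
  qed
  have "dir_deriv At (\<lambda>q. quantum_metric iv \<mu> q (s q y) (s q y')) p v =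
      mink_form (D y) (?\<theta> p w') + mink_form (?\<theta> p w) (D y')"
    using wder_eqI[OF wder_exists_mink_form[OF ex[of y] ex[of y']]]
    by (simp add: dir_deriv_def c_def[symmetric] o_def quantum_metric_def pc sy)
  then show ?thesis
    unfolding cov_deriv_bilinear_def y_def[symmetric] y'_def[symmetric] Let_def lorentz_defect_def
    by (simp add: D sy quantum_metric_def mink_form_diff_left mink_form_diff_right)
qed

text \<open>The chosen representative differs from \<open>u\<close> by some \<open>T\<close> in
  \<open>SO13\<close>; passing to its coordinates applies the inverse of \<open>T\<close>, which
  leaves the Minkowski form unchanged.\<close>

lemma coset_metric_frame:
  assumes u: "u \<in> frame_bundle At p" and c: "c \<in> charts_at At p"
  shows "coset_metric (coset u) (u y) (u y') = mink_form y y'"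
proof -
  define u' where "u' = (SOME u'. u' \<in> coset u)"
  have "u \<circ> id \<in> coset u" unfolding coset_def using id_in_SO13 by blast
  then have "u' \<in> coset u" unfolding u'_def by (rule someI[of "\<lambda>u'. u' \<in> coset u"])
  then obtain T where T: "T \<in> SO13" and u': "u' = u \<circ> T" unfolding coset_def by blast
  have bij: "bij T" using T by (simp add: SO13_def GL4_def)
  have inj: "inj u'" unfolding u' using frame_inj[OF u c] bij by (simp add: inj_compose bij_is_inj)
  have "inv_into UNIV u' (u z) = inv_into UNIV T z" for z
    by (rule inv_f_eq[OF inj]) (simp add: u' bij surj_f_inv_f bij_is_surj)
  then show ?thesis
    using SO13_preserves_mink_form[OF T, of "inv_into UNIV T y" "inv_into UNIV T y'"] bij
    unfolding coset_metric_def u'_def[symmetric] by (simp add: surj_f_inv_f bij_is_surj)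
qed

section \<open>Tangent vectors of a reduction and the Higgs frame\<close>

lemma zero_in_so13: "(\<lambda>_. 0) \<in> (so13 :: ('a::{real_algebra_1,t2_space}^4 \<Rightarrow> 'a^4) set)"
proof -
  have "(\<lambda>_. 0) = (*v) (0 :: 'a^4^4)" by (rule ext) simp
  then show ?thesis unfolding so13_def by (intro CollectI exI[of _ 0]) (simp add: zero_in_center)
qed

lemma pushforward_in_bundle_tangent:
  assumes s: "local_section At Q U s" "p \<in> U" and v: "v \<in> tangent_space At p"
  shows "pushforward At s p v \<in> bundle_tangent At so13 Q p (s p)"
proof -
  have fr: "s p \<in> frame_bundle At p" using s by (auto simp: local_section_def)
  \<comment> \<open>A frame sends 0 to 0: by additivity in the charts around \<open>p\<close>, and
    by the convention for tangent vectors elsewhere. Hence adding the vertical vector of 0 changes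
    nothing.\<close>
  have "s p 0 d = 0" for d
  proof (cases "d \<in> charts_at At p")
    case True
    then have "zlinear (*s) (*s) (\<lambda>y. s p y d)" using fr by (simp add: frame_bundle_def GL4_def)
    then have "s p (0 + 0) d = s p 0 d + s p 0 d" unfolding zlinear_def by blast
    then show ?thesis by simp
  next
    case False
    moreover have "s p 0 \<in> tangent_space At p" using fr unfolding frame_bundle_def by blast
    ultimately show ?thesis unfolding tangent_space_def by blast
  qed
  then have "pushforward At s p v = ft_add (pushforward At s p v) (vertical (s p) (\<lambda>_. 0))"
    by (simp add: ft_add_def vertical_def tadd_def)
  then show ?thesis unfolding bundle_tangent_def using s v zero_in_so13 by blast
qed

text \<open>A local lift \<open>e\<close> of the Higgs field is pseudo-orthonormal and lies in the
  reduction, where \<open>\<omega>\<close> restricts to an \<open>so13\<close>-valued connection. So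
  a constant is differentiated, and the remaining two terms cancel by skewness.\<close>

lemma (in topological_real_algebra) cov_deriv_metric_higgs_frame:
  fixes At :: "('m::t2_space, 'a) chart set" and \<mu> :: "'m \<Rightarrow> ('m, 'a) tvec \<Rightarrow> 'a^'i::finite"
  assumes man: "quantum_manifold At" and br: "from_higgs_breaking At (quantum_metric iv \<mu>) \<omega>"
  shows "\<exists>U e. p \<in> U \<and> local_section At (frame_bundle At) U e \<and>
    (\<forall>v\<in>tangent_space At p. \<forall>w\<in>tangent_space At p. \<forall>w'\<in>tangent_space At p.
       cov_deriv_bilinear At \<omega> e (quantum_metric iv \<mu>) p v w w' = 0)"
proof -
  let ?g = "quantum_metric iv \<mu>"
  obtain h \<omega>h where hf: "higgs_field At h"
    and g: "\<And>p v w. v \<in> tangent_space At p \<Longrightarrow> w \<in> tangent_space At p \<Longrightarrow>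
        ?g p v w = coset_metric (h p) v w"
    and pc: "principal_connection At SO13 so13 (reduction At h) \<omega>h"
    and ext: "\<And>p u \<zeta>. u \<in> reduction At h p \<Longrightarrow>
        \<zeta> \<in> bundle_tangent At so13 (reduction At h) p u \<Longrightarrow> \<omega> p u \<zeta> = \<omega>h p u \<zeta>"
    using br[unfolded from_higgs_breaking_def] by (elim exE conjE) (rule that; assumption | blast)
  obtain U e where pU: "p \<in> U" and e: "local_section At (frame_bundle At) U e"
    and h: "\<And>q. q \<in> U \<Longrightarrow> h q = coset (e q)"
    using conjunct2[OF hf[unfolded higgs_field_def], rule_format, of p] by auto
  have fr: "e q \<in> frame_bundle At q" if "q \<in> U" for q
    using e that by (auto simp: local_section_def)
  have red: "e q \<in> reduction At h q" if "q \<in> U" for q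
    using fr[OF that] h[OF that] by (simp add: reduction_def)
  have er: "local_section At (reduction At h) U e"
    using e red unfolding local_section_def by blast
  define c where "c = (SOME c. c \<in> charts_at At p)"
  have c: "c \<in> charts_at At p"
    unfolding c_def using charts_at_nonempty[OF man] by (rule someI_ex)
  then have cAt: "c \<in> At" "p \<in> cdom c" by (auto simp: charts_at_def)
  have ge: "?g q (e q y) (e q y') = mink_form y y'" if q: "q \<in> U" for q y y'
  proof -
    obtain d where "d \<in> charts_at At q" using charts_at_nonempty[OF man] by blast
    then show ?thesis
      using g[of "e q y" q "e q y'"] fr[OF q] coset_metric_frame[OF fr[OF q]] h[OF q]
      by (simp add: frame_bundle_def)
  qed
  have "cov_deriv_bilinear At \<omega> e ?g p v w w' = 0"
    if v: "v \<in> tangent_space At p" and w: "w \<in> tangent_space At p" "w' \<in> tangent_space At p"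
    for v w w'
  proof -
    let ?X = "\<omega> p (e p) (pushforward At e p v)"
    define y y' where "y = inv_into UNIV (e p) w" and "y' = inv_into UNIV (e p) w'"
    have ey: "e p y = w" "e p y' = w'"
      using frame_surj[OF fr[OF pU] c] w unfolding y_def y'_def by (metis f_inv_into_f rangeI)+
    have push: "pushforward At e p v \<in> bundle_tangent At so13 (reduction At h) p (e p)"
      by (rule pushforward_in_bundle_tangent[OF er pU v])
    \<comment> \<open>The pushforward is tangent to the reduction, so \<open>\<omega>\<close> may be
      replaced by \<open>\<omega>h\<close> there.\<close>
    have X: "?X \<in> so13"
      using conjunct1[OF pc[unfolded principal_connection_def], rule_format, OF red[OF pU]] push
      unfolding ext[OF red[OF pU] push] by (elim conjE) (rule bspec)
    have "wder ((\<lambda>q. ?g q (e q y) (e q y')) \<circ> cinv c) (cmap c p) (v c) = 0"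
    proof (rule wder_eq_0_of_locally_constant)
      show "open (cmap c ` (U \<inter> cdom c))" by (rule local_section_open_image[OF e cAt(1)])
      show "cmap c p \<in> cmap c ` (U \<inter> cdom c)" using pU cAt by blast
      show "((\<lambda>q. ?g q (e q y) (e q y')) \<circ> cinv c) x = mink_form y y'"
        if "x \<in> cmap c ` (U \<inter> cdom c)" for x
        using that cinv_cmap[OF man cAt(1)] ge by auto
    qed
    then have "dir_deriv At (\<lambda>q. ?g q (e q y) (e q y')) p v = 0"
      by (simp add: dir_deriv_def c_def[symmetric])
    then show ?thesis
      using so13_skew[OF X, of y y'] ge[OF pU, of "?X y" y'] ge[OF pU, of y "?X y'"]
      unfolding cov_deriv_bilinear_def y_def[symmetric] y'_def[symmetric] Let_def
      by (simp add: ey eq_neg_iff_add_eq_0[symmetric])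
  qed
  with pU e show ?thesis by blast
qed

theorem theorem3p11:
  fixes sK :: "'k::real_normed_field \<Rightarrow> 'a::{real_algebra_1,t2_space} \<Rightarrow> 'a"
    and A0 A1 :: "'a set"
    and At :: "('m::t2_space, 'a) chart set"
    and oddg :: "'i::finite \<Rightarrow> bool"
    and C :: "'i \<Rightarrow> 'i \<Rightarrow> 'i \<Rightarrow> 'a"
    and iv :: "4 \<Rightarrow> 'i" and il :: "4 \<Rightarrow> 4 \<Rightarrow> 'i"
    and \<kappa> :: "'a^'i^'i"
    and G :: "('m, 'a) chart \<Rightarrow> ('a^4) \<times> ('a^'i^4) \<Rightarrow> 'a^4^4"
    and \<mu> :: "'m \<Rightarrow> ('m, 'a) tvec \<Rightarrow> 'a^'i"
    and \<omega> :: "'m \<Rightarrow> ('m, 'a) frame \<Rightarrow> ('m, 'a) ftvec \<Rightarrow> 'a^4 \<Rightarrow> 'a^4"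
  assumes "quantum_superalgebra sK A0 A1"
    and "quantum_manifold At"
    and "poincare_superextension A0 oddg C iv il"
    and "contraction_metrics At A0 \<kappa> G \<mu>"
    and "YM_solution At C \<kappa> G \<mu>"
    and "is_vierbein At (vierbein iv \<mu>)"
    and "levi_civita_belonging At iv il \<mu> \<omega>"
    and "from_higgs_breaking At (quantum_metric iv \<mu>) \<omega>"
  shows "\<forall>p U s. p \<in> U \<and> local_section At (frame_bundle At) U s \<longrightarrow>
    (\<forall>v\<in>tangent_space At p. \<forall>w\<in>tangent_space At p. \<forall>w'\<in>tangent_space At p.
       cov_deriv_bilinear At \<omega> s (quantum_metric iv \<mu>) p v w w' = 0)"
proof (intro allI impI ballI)
  fix p U s v w w'
  assume s: "p \<in> U \<and> local_section At (frame_bundle At) U s"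
    and vw: "v \<in> tangent_space At p" "w \<in> tangent_space At p" "w' \<in> tangent_space At p"
  interpret topological_real_algebra "TYPE('a)"
    by (rule topological_real_algebra_quantum[OF assms(1)])
  have hom: "hom_section At \<mu>" using assms(5) by (simp add: YM_solution_def)
  obtain V e where e: "p \<in> V" "local_section At (frame_bundle At) V e"
    "cov_deriv_bilinear At \<omega> e (quantum_metric iv \<mu>) p v w w' = 0"
    using cov_deriv_metric_higgs_frame[OF assms(2,8)] vw by blast
  \<comment> \<open>The defect contains no frame, so its vanishing, obtained from \<open>e\<close>,
    carries over to the arbitrary frame \<open>s\<close>.\<close>
  have "lorentz_defect iv il \<mu> p v w w' = 0"
    using cov_deriv_metric_eq_defect[OF assms(2) hom assms(7) e(2,1) vw] e(3) by simp
  then show "cov_deriv_bilinear At \<omega> s (quantum_metric iv \<mu>) p v w w' = 0"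
    using cov_deriv_metric_eq_defect[OF assms(2) hom assms(7) _ _ vw, of U s] s by simp
qed

end
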